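(* Let $d\colon\mathcal{X}\times\mathcal{X}\to[0,1]$ be a normalized distance, let $m,M\in(0,1)$ with $m\le M$, and let $\mathcal{S}$ be the outlier-score suppression algorithm, which independently deletes each record $x\in D$ with probability $\mathrm{out}_D(x)$, i.e. \[ \Pr\{\mathcal{S}(D)=C\}=\prod_{x\in C}(1-\mathrm{out}_D(x))\prod_{x\in D\setminus C}\mathrm{out}_D(x) \] for all $D\in\mathcal{D}$ and all $C\subseteq D$. If $\mathcal{M}$ with domain $\mathcal{D}$ is unbounded $(\varepsilon,\delta)$-DP, then $\mathcal{M}\circ\mathcal{S}$ is unbounded $(\varepsilon^{\mathcal{S}},\delta^{\mathcal{S}})$-DP with $\delta^{\mathcal{S}}=\delta(1-m)$ and $\varepsilon^{\mathcal{S}}$ equal, up to an error of $2\cdot10^{-7}$, to \[ \max_{p\in[0,1]}\max\{l_1(p),l_2(p),l_3\}, \] where \[ l_1(p)=\ln\big(e^{\varepsilon}-(e^{\varepsilon}-1)(pM+(1-p)m)\big)+p\frac{M}{m}+(1-p)\frac{1-m}{1-(pM+(1-p)m)}-1, \] \[ l_2(p)=\ln\Big(e^{\varepsilon}-(e^{\varepsilon}-1)\Big(pM+(1-p)\frac{(M+m)-pM}{2-p}\Big)\Big)+p\frac{M}{m}+(1-p)\frac{1-\frac{(M+m)-pM}{2-p}}{1-M}-1, \] \[ l_3=-\ln\big(e^{-\varepsilon}+(1-e^{-\varepsilon})M\big)+1-\frac{1-M}{1-m}. \]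
   Context: Let $\mathcal{X}$ be a set and $\mathcal{D}$ a class of finite multisets of elements of $\mathcal{X}$ (databases), closed under taking sub-multisets. Two databases are (unbounded) neighboring if one is obtained from the other by adding exactly one record. A randomized mechanism $\mathcal{M}$ with domain $\mathcal{D}$ (outputs in a measurable space $\mathcal{R}$) is unbounded $(\varepsilon,\delta)$-DP if for all neighboring $D,D'\in\mathcal{D}$ (either order) and all measurable $E\subseteq\mathcal{R}$, $\Pr\{\mathcal{M}(D)\in E\}\le e^{\varepsilon}\Pr\{\mathcal{M}(D')\in E\}+\delta$. A suppression algorithm $\mathcal{S}$ assigns to each $D$ a discrete random variable $\mathcal{S}(D)$ taking sub-multisets of $D$ as values; $\mathcal{M}\circ\mathcal{S}$ is $D\mapsto\mathcal{M}(\mathcal{S}(D))$ with independent randomness. A normalized distance is a metric $d$ on $\mathcal{X}$ with values in $[0,1]$ and $\sup_{x,y}d(x,y)=1$. Its $(m,M)$-transformation is $\tilde d(x,y)=m+(M-m)d(x,y)\in[m,M]$. For non-empty $D\in\mathcal{D}$ and $x\in D$, the outlier score is $\mathrm{out}_D(x)=\frac{1}{|D|}\sum_{y\in D}\tilde d(x,y)$ (sum with multiplicity); for $D=\varnothing$, $\mathcal{S}(\varnothing)=\varnothing$. *)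

theory Defs
  imports "HOL-Probability.Probability" "HOL-Library.Multiset"
begin

text \<open>Records are elements of the type 'a (the set X); databases are 'a multisets.\<close>

definition normalized_distance :: "('a \<Rightarrow> 'a \<Rightarrow> real) \<Rightarrow> bool" where
  "normalized_distance d \<longleftrightarrow>
     (\<forall>x y. 0 \<le> d x y \<and> d x y \<le> 1) \<and>
     (\<forall>x y. d x y = 0 \<longleftrightarrow> x = y) \<and>
     (\<forall>x y. d x y = d y x) \<and>
     (\<forall>x y z. d x z \<le> d x y + d y z) \<and>
     (SUP xy\<in>UNIV. d (fst xy) (snd xy)) = 1"

definition transformed_distance :: "('a \<Rightarrow> 'a \<Rightarrow> real) \<Rightarrow> real \<Rightarrow> real \<Rightarrow> 'a \<Rightarrow> 'a \<Rightarrow> real" where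
  "transformed_distance d m M x y = m + (M - m) * d x y"

definition outlier_score :: "('a \<Rightarrow> 'a \<Rightarrow> real) \<Rightarrow> real \<Rightarrow> real \<Rightarrow> 'a multiset \<Rightarrow> 'a \<Rightarrow> real" where
  "outlier_score d m M D x =
     (1 / real (size D)) * sum_mset (image_mset (\<lambda>y. transformed_distance d m M x y) D)"

definition subset_closed :: "'a multiset set \<Rightarrow> bool" where
  "subset_closed \<D> \<longleftrightarrow> (\<forall>D\<in>\<D>. \<forall>C. C \<subseteq># D \<longrightarrow> C \<in> \<D>)"

text \<open>Unbounded (eps,delta)-DP of a mechanism given through its event probabilities
  P D E = Pr{mechanism(D) \<in> E}, for events E in the sigma-algebra of R.
  Neighbouring: D' = D + {#x#}, both orders.\<close>
definition unbounded_DP ::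
  "'a multiset set \<Rightarrow> 'r measure \<Rightarrow> ('a multiset \<Rightarrow> 'r set \<Rightarrow> real) \<Rightarrow> real \<Rightarrow> real \<Rightarrow> bool" where
  "unbounded_DP \<D> R P \<epsilon> \<delta> \<longleftrightarrow>
     (\<forall>D\<in>\<D>. \<forall>x. add_mset x D \<in> \<D> \<longrightarrow> (\<forall>E\<in>sets R.
        P D E \<le> exp \<epsilon> * P (add_mset x D) E + \<delta> \<and>
        P (add_mset x D) E \<le> exp \<epsilon> * P D E + \<delta>))"

definition mechanism :: "'a multiset set \<Rightarrow> 'r measure \<Rightarrow> ('a multiset \<Rightarrow> 'r measure) \<Rightarrow> bool" where
  "mechanism \<D> R Mech \<longleftrightarrow> (\<forall>D\<in>\<D>. prob_space (Mech D) \<and> sets (Mech D) = sets R)"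

definition suppression :: "'a multiset set \<Rightarrow> ('a multiset \<Rightarrow> 'a multiset pmf) \<Rightarrow> bool" where
  "suppression \<D> S \<longleftrightarrow> (\<forall>D\<in>\<D>. set_pmf (S D) \<subseteq> {C. C \<subseteq># D})"

text \<open>Pr{(Mech o S)(D) \<in> E}, with independent randomness of S and Mech.\<close>
definition comp_prob ::
  "('a multiset \<Rightarrow> 'r measure) \<Rightarrow> ('a multiset \<Rightarrow> 'a multiset pmf) \<Rightarrow> 'a multiset \<Rightarrow> 'r set \<Rightarrow> real" where
  "comp_prob Mech S D E = measure_pmf.expectation (S D) (\<lambda>C. measure (Mech C) E)"

text \<open>Law of independent deletion of each record x of D with probability q x
  (records are distinguishable occurrences, hence the binomial factors for multiplicities).\<close>
definition indep_deletion_prob :: "('a \<Rightarrow> real) \<Rightarrow> 'a multiset \<Rightarrow> 'a multiset \<Rightarrow> real" where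
  "indep_deletion_prob q D C =
     (\<Prod>x\<in>set_mset D. real (count D x choose count C x) *
        (1 - q x) ^ count C x * q x ^ (count D x - count C x))"

definition l1 :: "real \<Rightarrow> real \<Rightarrow> real \<Rightarrow> real \<Rightarrow> real" where
  "l1 \<epsilon> m M p =
     ln (exp \<epsilon> - (exp \<epsilon> - 1) * (p * M + (1 - p) * m))
     + p * (M / m) + (1 - p) * ((1 - m) / (1 - (p * M + (1 - p) * m))) - 1"

definition l2 :: "real \<Rightarrow> real \<Rightarrow> real \<Rightarrow> real \<Rightarrow> real" where
  "l2 \<epsilon> m M p =
     (let r = ((M + m) - p * M) / (2 - p) in
      ln (exp \<epsilon> - (exp \<epsilon> - 1) * (p * M + (1 - p) * r))
      + p * (M / m) + (1 - p) * ((1 - r) / (1 - M)) - 1)"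

definition l3 :: "real \<Rightarrow> real \<Rightarrow> real \<Rightarrow> real" where
  "l3 \<epsilon> m M = - ln (exp (-\<epsilon>) + (1 - exp (-\<epsilon>)) * M) + 1 - (1 - M) / (1 - m)"

definition eps_bound :: "real \<Rightarrow> real \<Rightarrow> real \<Rightarrow> real" where
  "eps_bound \<epsilon> m M = (SUP p\<in>{0..1}. max (max (l1 \<epsilon> m M p) (l2 \<epsilon> m M p)) (l3 \<epsilon> m M))"

end

theory Submission
  imports Defs
begin

text \<open>
  Write \<open>D' = D + z\<close>, \<open>n = |D|\<close>, \<open>s y = d y z\<close>, and let \<open>\<sigma>\<close> be the mean of \<open>s\<close> over \<open>D\<close>; the deletion
  probability of \<open>z\<close> is \<open>x = m + (M - m) n \<sigma> / (n + 1)\<close>. Conditioning on the fate of \<open>z\<close> loses a factor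
  \<open>exp (gain_up f x)\<close> or \<open>exp (gain_down f x)\<close>, \<open>f = exp \<epsilon> - 1\<close>, and the remaining loss is the ratio of
  the two laws of deletion on \<open>D\<close>, which factorises over the records. By the triangle inequality the
  normalised score of \<open>y\<close> is at most \<open>min 1 (s y + \<sigma>)\<close>, so the logarithm of the factor of \<open>y\<close> is bounded
  by a function of \<open>s y\<close> that lies below every affine function dominating it at \<open>0\<close>, \<open>1\<close> and at one kink.
  Averaging a suitable affine majorant over \<open>D\<close> leaves inequalities in a few real parameters. When
  \<open>D'\<close> is bounded by \<open>D\<close>, the chord from \<open>0\<close> to \<open>1\<close> gives \<open>l1\<close> and the chords through the kink
  give \<open>l2\<close>; the reverse direction is dominated by \<open>l1\<close>, \<open>l2\<close> or \<open>l3\<close> depending on \<open>m\<close> and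
  \<open>(M - m) / (1 - m)\<close>. All comparisons are exact, so \<open>\<epsilon>S\<close> can be taken to be the maximum itself.
\<close>

section \<open>Logarithmic gains and affine majorants\<close>

text \<open>For \<open>f = exp \<epsilon> - 1\<close> the exponential is
  \<open>x + (1 - x) * exp \<epsilon>\<close>: the loss in bounding \<open>D'\<close> by
  \<open>D\<close> when the new record is deleted with probability \<open>x\<close>.\<close>

definition gain_up :: "real \<Rightarrow> real \<Rightarrow> real" where
  "gain_up f x = ln (1 + f * (1 - x))"

text \<open>For \<open>f = exp \<epsilon> - 1\<close> the exponential is the reciprocal of
  \<open>x + (1 - x) * exp (-\<epsilon>)\<close>: the loss in the opposite direction.\<close>

definition gain_down :: "real \<Rightarrow> real \<Rightarrow> real" where
  "gain_down f x = ln ((1 + f) / (1 + f * x))"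

section \<open>Elementary estimates for the gains and the logarithm\<close>

lemma divide_le_divide_cross:
  fixes a b c d :: real
  assumes "0 < b" "0 < d" "a * d \<le> c * b"
  shows "a / b \<le> c / d"
  using assms by (simp add: pos_divide_le_eq pos_le_divide_eq)

lemma gain_up_antimono:
  assumes "0 \<le> f" "x \<le> y" "y \<le> 1"
  shows "gain_up f y \<le> gain_up f x"
proof -
  have "0 \<le> f * (1 - y)" "f * (1 - y) \<le> f * (1 - x)"
    using assms by (auto intro: mult_left_mono)
  then show ?thesis by (simp add: gain_up_def)
qed

text \<open>\<open>ln t \<le> t - 1\<close> for the quotient of the arguments. The bound is the
  limit for large \<open>f\<close> and free of \<open>f\<close>, so a shift of the deletion
  probability can be paid from terms without \<epsilon>.\<close>

lemma gain_up_diff_le: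
  assumes "0 \<le> f" "x \<le> y" "y < 1"
  shows "gain_up f x - gain_up f y \<le> (y - x) / (1 - y)"
proof -
  have Y: "0 \<le> f * (1 - y)" using assms by simp
  have X: "0 \<le> f * (1 - x)" using assms by simp
  have "gain_up f x - gain_up f y = ln ((1 + f * (1 - x)) / (1 + f * (1 - y)))"
    unfolding gain_up_def using X Y by (subst ln_div) auto
  also have "\<dots> \<le> (1 + f * (1 - x)) / (1 + f * (1 - y)) - 1"
    by (rule ln_le_minus_one) (use X Y in \<open>auto intro!: divide_pos_pos\<close>)
  also have "\<dots> = f * (y - x) / (1 + f * (1 - y))"
    using Y by (simp add: field_simps)
  also have "\<dots> \<le> (y - x) / (1 - y)"
  proof -
    have "f * (y - x) * (1 - y) \<le> (y - x) * (1 + f * (1 - y))"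
      using assms by (simp add: algebra_simps)
    then show ?thesis using assms Y by (intro divide_le_divide_cross add_pos_nonneg) auto
  qed
  finally show ?thesis .
qed

text \<open>Again \<open>ln t \<le> t - 1\<close>, but with \<open>f\<close> kept: the comparison
  with \<open>l3\<close> needs the ratio \<open>f / (1 + f * x)\<close> itself; elsewhere it is
  weakened to \<open>1 / x\<close>.\<close>

lemma gain_down_diff_le:
  assumes "0 \<le> f" "0 \<le> x" "x \<le> y"
  shows "gain_down f x - gain_down f y \<le> (y - x) * (f / (1 + f * x))"
proof -
  have X: "0 < 1 + f * x" "0 < 1 + f * y" "0 < 1 + f" using assms by (auto intro: add_pos_nonneg)
  have "gain_down f x - gain_down f y = ln ((1 + f * y) / (1 + f * x))"
    unfolding gain_down_def using X assms by (simp add: ln_div)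
  also have "\<dots> \<le> (1 + f * y) / (1 + f * x) - 1"
    by (rule ln_le_minus_one) (use X in \<open>auto intro!: divide_pos_pos\<close>)
  also have "\<dots> = (y - x) * (f / (1 + f * x))"
    using X by (simp add: field_simps)
  finally show ?thesis .
qed

text \<open>\<open>(1 + f * (1 - x)) * (1 + f * x)\<close> exceeds \<open>1 + f\<close> by
  \<open>x * (1 - x) * f\<^sup>2\<close>. The gap is the reserve when the removal of a record is
  compared with \<open>l1\<close>, which contains \<open>gain_up\<close>.\<close>

lemma gain_gap:
  assumes "0 \<le> f" "0 \<le> x" "x \<le> 1"
  shows "gain_up f x - gain_down f x = ln (1 + x * (1 - x) * (f\<^sup>2 / (1 + f)))"
proof -
  have X: "0 < 1 + f * x" "0 < 1 + f * (1 - x)" "0 < 1 + f" using assms by (auto intro: add_pos_nonneg)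
  have "gain_up f x - gain_down f x = ln ((1 + f * (1 - x)) * ((1 + f * x) / (1 + f)))"
    unfolding gain_up_def gain_down_def using X assms by (simp add: ln_div ln_mult)
  also have "(1 + f * (1 - x)) * ((1 + f * x) / (1 + f)) = 1 + x * (1 - x) * (f\<^sup>2 / (1 + f))"
    using assms by (simp add: field_simps power2_eq_square)
  finally show ?thesis .
qed

lemma gain_down_le_up:
  assumes "0 \<le> f" "0 \<le> x" "x \<le> 1"
  shows "gain_down f x \<le> gain_up f x"
proof -
  have "0 \<le> ln (1 + x * (1 - x) * (f\<^sup>2 / (1 + f)))"
    using assms by simp
  then show ?thesis using gain_gap[OF assms] by linarith
qed

lemma ln_ge_frac:
  assumes "0 \<le> (z::real)"
  shows "z / (1 + z) \<le> ln (1 + z)"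
proof -
  have "ln (1 / (1 + z)) \<le> 1 / (1 + z) - 1"
    by (rule ln_le_minus_one) (use assms in auto)
  then show ?thesis using assms by (simp add: ln_div field_simps)
qed

text \<open>In the power series of \<open>- ln (1 - v)\<close> all coefficients from order two on
  are replaced by \<open>1 / 2\<close>. The difference of the sides has derivative
  \<open>t\<^sup>2 / (2 * (1 - t)\<^sup>2)\<close>.\<close>

lemma minus_ln_le:
  assumes "0 \<le> v" "v < (1::real)"
  shows "- ln (1 - v) \<le> v * (1 + v / (2 * (1 - v)))"
proof -
  let ?g = "\<lambda>t::real. t * (1 + t / (2 * (1 - t))) + ln (1 - t)"
  have "?g 0 \<le> ?g v"
  proof (rule DERIV_nonneg_imp_nondecreasing[OF assms(1)])
    fix t assume t: "0 \<le> t" "t \<le> v"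
    then have "t < 1" using assms by simp
    then have "(?g has_real_derivative
        1 + ((2 * t) * (2 * (1 - t)) + t * t * 2) / (2 * (1 - t))\<^sup>2 - 1 / (1 - t)) (at t)"
      by (auto intro!: derivative_eq_intros simp: power2_eq_square) (simp add: divide_simps, algebra)
    moreover have "1 + ((2 * t) * (2 * (1 - t)) + t * t * 2) / (2 * (1 - t))\<^sup>2 - 1 / (1 - t) = t\<^sup>2 / (2 * (1 - t)\<^sup>2)"
      using \<open>t < 1\<close> by (simp add: divide_simps power2_eq_square) (simp add: algebra_simps)?
    ultimately show "\<exists>y. (?g has_real_derivative y) (at t) \<and> 0 \<le> y" by fastforce
  qed
  then show ?thesis by simp
qed

text \<open>The left-hand side is increasing in \<open>u\<close>; after putting \<open>u = min 1 (s + \<sigma>)\<close> it is convex in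
  \<open>s\<close> on \<open>[0, 1 - \<sigma>]\<close> and affine on \<open>[1 - \<sigma>, 1]\<close>, so three points decide.\<close>
lemma affine_majorant_three_points:
  fixes A E c \<alpha> \<beta> s u \<sigma> :: real
  assumes A: "0 < A" "0 < A + E" and c: "0 \<le> c" and \<sigma>: "0 \<le> \<sigma>" "\<sigma> \<le> 1"
    and s: "0 \<le> s" "s \<le> 1" and u: "0 \<le> u" "u \<le> 1" "u \<le> s + \<sigma>"
    and p0: "c * \<sigma> / (A + E * \<sigma>) \<le> \<alpha>"
    and p1: "c * \<sigma> / (A + E) \<le> \<alpha> + \<beta> * (1 - \<sigma>)"
    and p2: "0 \<le> \<alpha> + \<beta>"
  shows "c * (u - s) / (A + E * u) \<le> \<alpha> + \<beta> * s"
proof -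
  have den: "0 < A + E * v" if "0 \<le> v" "v \<le> 1" for v
  proof -
    have eq: "A + E * v = (1 - v) * A + v * (A + E)" by (simp add: algebra_simps)
    show ?thesis
    proof (cases "v = 0")
      case False
      then have "0 < v * (A + E)" "0 \<le> (1 - v) * A" using A that by auto
      then show ?thesis unfolding eq by linarith
    qed (use A in simp)
  qed
  have mono: "c * (v - s) / (A + E * v) \<le> c * (w - s) / (A + E * w)"
    if "0 \<le> v" "v \<le> w" "w \<le> 1" for v w
  proof -
    \<comment> \<open>The cross-multiplied difference of the quotients; its sign is that of
      \<open>A + E * s\<close>, which is positive.\<close>
    have "(w - s) * (A + E * v) - (v - s) * (A + E * w) = (w - v) * (A + E * s)"
      by (simp add: algebra_simps)
    moreover have "0 \<le> (w - v) * (A + E * s)" using that den[of s] s by simp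
    ultimately have "(v - s) * (A + E * w) \<le> (w - s) * (A + E * v)" by linarith
    then have "(v - s) / (A + E * v) \<le> (w - s) / (A + E * w)"
      using den[of v] den[of w] that by (simp add: divide_simps mult_ac)
    then show ?thesis using c by (metis mult_left_mono times_divide_eq_right)
  qed
  show ?thesis
  proof (cases "s + \<sigma> \<le> 1")
    case True
    have "c * (u - s) / (A + E * u) \<le> c * \<sigma> / (A + E * (s + \<sigma>))"
      using mono[of u "s + \<sigma>"] u True by simp
    also have "\<dots> \<le> \<alpha> + \<beta> * s"
    proof (cases "\<sigma> = 1")
      case True
      then have "s = 0" using \<open>s + \<sigma> \<le> 1\<close> s by simp
      then show ?thesis using p0 True by simp
    next
      case False
      \<comment> \<open>Weight of the kink \<open>1 - \<sigma>\<close> when \<open>s\<close> is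
        written as a convex combination of \<open>0\<close> and the kink; the denominator becomes
        the same combination of its end values.\<close>
      define \<theta> where "\<theta> = s / (1 - \<sigma>)"
      have \<theta>: "0 \<le> \<theta>" "\<theta> \<le> 1" "s = \<theta> * (1 - \<sigma>)"
        using False \<sigma> s True by (auto simp: \<theta>_def divide_simps)
      let ?x = "A + E * \<sigma>" and ?y = "A + E"
      have xy: "0 < ?x" "0 < ?y" using den[of \<sigma>] \<sigma> A by auto
      have mid: "A + E * (s + \<sigma>) = (1 - \<theta>) * ?x + \<theta> * ?y"
        unfolding \<theta>(3) by (simp add: algebra_simps)
      have pos: "0 < (1 - \<theta>) * ?x + \<theta> * ?y"
        using den[of "s + \<sigma>"] True s \<sigma> mid by simp
      have "1 / ((1 - \<theta>) * ?x + \<theta> * ?y) \<le> (1 - \<theta>) / ?x + \<theta> / ?y"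
      proof -
        \<comment> \<open>Convexity of the reciprocal, cleared of denominators.\<close>
        have "((1 - \<theta>) * ?y + \<theta> * ?x) * ((1 - \<theta>) * ?x + \<theta> * ?y) - ?x * ?y = \<theta> * (1 - \<theta>) * (?x - ?y)\<^sup>2"
          by (simp add: algebra_simps power2_eq_square)
        moreover have "0 \<le> \<theta> * (1 - \<theta>) * (?x - ?y)\<^sup>2" using \<theta> by simp
        ultimately have k: "?x * ?y \<le> ((1 - \<theta>) * ?y + \<theta> * ?x) * ((1 - \<theta>) * ?x + \<theta> * ?y)" by linarith
        have "1 / ((1 - \<theta>) * ?x + \<theta> * ?y) \<le> ((1 - \<theta>) * ?y + \<theta> * ?x) / (?x * ?y)"
          using k pos xy by (simp add: divide_simps mult_ac)
        also have "\<dots> = (1 - \<theta>) / ?x + \<theta> / ?y" using xy by (simp add: add_divide_distrib)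
        finally show ?thesis .
      qed
      then have "c * \<sigma> * (1 / (A + E * (s + \<sigma>))) \<le> c * \<sigma> * ((1 - \<theta>) / ?x + \<theta> / ?y)"
        unfolding mid using c \<sigma> by (intro mult_left_mono) auto
      also have "\<dots> = (1 - \<theta>) * (c * \<sigma> / ?x) + \<theta> * (c * \<sigma> / ?y)"
        by (simp add: algebra_simps)
      also have "\<dots> \<le> (1 - \<theta>) * \<alpha> + \<theta> * (\<alpha> + \<beta> * (1 - \<sigma>))"
        using p0 p1 \<theta> by (intro add_mono mult_left_mono) auto
      also have "\<dots> = \<alpha> + \<beta> * s" unfolding \<theta>(3) by (simp add: algebra_simps)
      finally show ?thesis by simp
    qed
    finally show ?thesis .
  next
    case False
    then have \<sigma>0: "0 < \<sigma>" using s by linarith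
    \<comment> \<open>Weight of the kink when \<open>s\<close> is written as a convex combination of
      \<open>1 - \<sigma>\<close> and \<open>1\<close>. With \<open>u = 1\<close> the left-hand side
      vanishes at \<open>s = 1\<close>, so only the kink contributes.\<close>
    define \<tau> where "\<tau> = (1 - s) / \<sigma>"
    have \<tau>: "0 \<le> \<tau>" "\<tau> \<le> 1" "s = 1 - \<tau> * \<sigma>"
      using False \<sigma>0 s by (auto simp: \<tau>_def divide_simps)
    have "c * (u - s) / (A + E * u) \<le> c * (1 - s) / (A + E)"
      using mono[of u 1] u by simp
    also have "\<dots> = \<tau> * (c * \<sigma> / (A + E))" unfolding \<tau>(3) by (simp add: algebra_simps)
    also have "\<dots> \<le> \<tau> * (\<alpha> + \<beta> * (1 - \<sigma>))" using p1 \<tau> by (intro mult_left_mono)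
    also have "\<dots> \<le> \<tau> * (\<alpha> + \<beta> * (1 - \<sigma>)) + (1 - \<tau>) * (\<alpha> + \<beta>)" using p2 \<tau> by simp
    also have "\<dots> = \<alpha> + \<beta> * s" unfolding \<tau>(3) by (simp add: algebra_simps)
    finally show ?thesis .
  qed
qed

section \<open>Adding a record\<close>

text \<open>\<open>B\<close> stands for the maximum in the theorem, known only through three
  families of lower bounds: \<open>l1\<close> at \<open>p\<close>, \<open>l2\<close> at
  \<open>p = 2 - y\<close>, and \<open>l3\<close>, each rewritten with the gains.\<close>

locale suppression_bound =
  fixes m M f B :: real
  assumes m_pos: "0 < m" and m_le_M: "m \<le> M" and M_less_1: "M < 1" and f_nonneg: "0 \<le> f"
    and bound1: "\<And>p. 0 \<le> p \<Longrightarrow> p \<le> 1 \<Longrightarrow>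
      gain_up f (m + (M - m) * p) + p * ((M - m) / m) + (1 - p) * p * ((M - m) / (1 - m - (M - m) * p)) \<le> B"
    and bound2: "\<And>y. 1 \<le> y \<Longrightarrow> y \<le> 2 \<Longrightarrow>
      gain_up f (m + (M - m) / y) + (M - m) / y * ((2 * y - y\<^sup>2) / m + (y - 1) / (1 - M)) \<le> B"
    and bound3: "gain_down f M + (M - m) / (1 - m) \<le> B"
begin

text \<open>This is \<open>l2\<close> at \<open>p = 0\<close>, the reference for all arguments that
  move the deletion probability of \<open>z\<close> to the midpoint
  \<open>m + (M - m) / 2\<close>.\<close>

lemma bound2_mid: "gain_up f (m + (M - m) / 2) + (M - m) / (2 * (1 - M)) \<le> B"
  using bound2[of 2] by simp

lemma score_le_M:
  assumes "0 \<le> p" "p \<le> 1"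
  shows "m + (M - m) * p \<le> M"
  using mult_left_mono[of p 1 "M - m"] assms m_le_M by simp

lemma m_le_score:
  assumes "0 \<le> p"
  shows "m \<le> m + (M - m) * p"
  using assms m_le_M by simp

text \<open>The chord from \<open>s = 0\<close> to \<open>s = 1\<close>, evaluated at the mean
  \<sigma>. The quotient \<open>(1 - t) / (1 - m - (M - m) * t)\<close> decreases in
  \<open>t\<close>, so \<sigma> may be replaced there by the smaller
  \<open>\<kappa> * \<sigma>\<close>, which gives \<open>l1\<close> at that parameter.\<close>

lemma forward_kink_below:
  assumes "0 \<le> \<kappa>" "\<kappa> \<le> 1" "0 \<le> \<sigma>" "\<sigma> \<le> 1"
  shows "gain_up f (m + (M - m) * (\<kappa> * \<sigma>))
    + \<kappa> * ((1 - \<sigma>) * ((M - m) * \<sigma> / (1 - m - (M - m) * \<sigma>)) + \<sigma> * ((M - m) / m)) \<le> B"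
proof -
  let ?\<mu> = "\<kappa> * \<sigma>" and ?D = "M - m" and ?a = "1 - m"
  have \<mu>: "0 \<le> ?\<mu>" "?\<mu> \<le> \<sigma>" "?\<mu> \<le> 1" using assms by (auto intro: mult_le_one mult_left_le_one_le)
  have pos: "0 < ?a - ?D * \<sigma>" "0 < ?a - ?D * ?\<mu>"
    using score_le_M[of \<sigma>] score_le_M[of ?\<mu>] assms \<mu> M_less_1 by auto
  have "(1 - \<sigma>) * (?a - ?D * ?\<mu>) \<le> (1 - ?\<mu>) * (?a - ?D * \<sigma>)"
  proof -
    have "(1 - ?\<mu>) * (?a - ?D * \<sigma>) - (1 - \<sigma>) * (?a - ?D * ?\<mu>) = (\<sigma> - ?\<mu>) * (?a - ?D)"
      by (simp add: algebra_simps)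
    moreover have "0 \<le> (\<sigma> - ?\<mu>) * (?a - ?D)" using \<mu> M_less_1 by simp
    ultimately show ?thesis by linarith
  qed
  then have "(1 - \<sigma>) / (?a - ?D * \<sigma>) \<le> (1 - ?\<mu>) / (?a - ?D * ?\<mu>)"
    using pos by (simp add: divide_simps mult_ac)
  then have "?\<mu> * ?D * ((1 - \<sigma>) / (?a - ?D * \<sigma>)) \<le> ?\<mu> * ?D * ((1 - ?\<mu>) / (?a - ?D * ?\<mu>))"
    using \<mu> m_le_M by (intro mult_left_mono) auto
  then show ?thesis using bound1[of ?\<mu>] \<mu> by (simp add: algebra_simps)
qed

text \<open>The line through the values at \<open>s = 0\<close> and at the kink, evaluated at
  \<sigma>. Moving the deletion probability to the midpoint costs what the linear part falls short
  of, and \<open>bound2_mid\<close> absorbs the sum.\<close>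

lemma forward_few_far:
  assumes "0 \<le> \<kappa>" "\<kappa> \<le> 1" "0 \<le> \<sigma>" "\<sigma> \<le> 1 / 2"
  shows "gain_up f (m + (M - m) * (\<kappa> * \<sigma>))
    + \<kappa> * ((M - m) * \<sigma> / (1 - m - (M - m) * \<sigma>) * (1 + (M - m) / (1 - M) * \<sigma>)) \<le> B"
proof -
  let ?\<mu> = "\<kappa> * \<sigma>" and ?D = "M - m" and ?a = "1 - m" and ?b = "1 - M"
  have \<mu>: "0 \<le> ?\<mu>" "?\<mu> \<le> \<sigma>" using assms by (auto intro: mult_left_le_one_le)
  have b: "0 < ?b" using M_less_1 by simp
  have D: "0 \<le> ?D" using m_le_M by simp
  have h: "0 < ?a - ?D / 2" using b D by (simp add: field_simps)
  have le: "?a - ?D / 2 \<le> ?a - ?D * \<sigma>" using mult_left_mono[of \<sigma> "1/2" ?D] D assms by simp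
  have "gain_up f (m + ?D * ?\<mu>) - gain_up f (m + ?D / 2) \<le> (?D / 2 - ?D * ?\<mu>) / (?a - ?D / 2)"
  proof -
    have "?D * ?\<mu> \<le> ?D / 2" using mult_left_mono[of ?\<mu> "1/2" ?D] D \<mu> assms by simp
    then have "gain_up f (m + ?D * ?\<mu>) - gain_up f (m + ?D / 2)
        \<le> ((m + ?D / 2) - (m + ?D * ?\<mu>)) / (1 - (m + ?D / 2))"
      using h by (intro gain_up_diff_le f_nonneg) (auto simp: field_simps)
    moreover have "(m + ?D / 2) - (m + ?D * ?\<mu>) = ?D / 2 - ?D * ?\<mu>" "1 - (m + ?D / 2) = ?a - ?D / 2" by auto
    ultimately show ?thesis by simp
  qed
  moreover have "\<kappa> * (?D * \<sigma> / (?a - ?D * \<sigma>) * (1 + ?D / ?b * \<sigma>))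
      \<le> ?D * ?\<mu> / (?a - ?D / 2) + ?D / (?a - ?D / 2) * (?D / (4 * ?b))"
  proof -
    have "\<kappa> * (?D * \<sigma> / (?a - ?D * \<sigma>) * (1 + ?D / ?b * \<sigma>)) = ?D * ?\<mu> * (1 + ?D / ?b * \<sigma>) / (?a - ?D * \<sigma>)"
      by simp
    also have "\<dots> \<le> ?D * ?\<mu> * (1 + ?D / ?b * \<sigma>) / (?a - ?D / 2)"
      using le h D b \<mu> assms by (intro divide_left_mono mult_nonneg_nonneg add_nonneg_nonneg mult_pos_pos) auto
    also have "\<dots> = ?D * ?\<mu> / (?a - ?D / 2) + ?D / (?a - ?D / 2) * (?D / ?b * (?\<mu> * \<sigma>))"
    proof -
      have "d * u * (1 + d / b * s) / z = d * u / z + d / z * (d / b * (u * s))" for d u b s z :: real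
        by (simp add: add_divide_distrib distrib_left mult_ac)
      then show ?thesis .
    qed
    \<comment> \<open>Only the product \<open>\<mu> * \<sigma>\<close> is estimated, by
      \<open>1 / 4\<close>; with this value the total below is exactly
      \<open>?D / (2 * ?b)\<close>.\<close>
    also have "\<dots> \<le> ?D * ?\<mu> / (?a - ?D / 2) + ?D / (?a - ?D / 2) * (?D / ?b * (1 / 2 * (1 / 2)))"
      using \<mu> assms D b h by (intro add_left_mono mult_left_mono mult_mono) (auto intro!: divide_nonneg_nonneg)
    also have "?D / ?b * (1 / 2 * (1 / 2)) = ?D / (4 * ?b)" by simp
    finally show ?thesis .
  qed
  moreover have "(?D / 2 - ?D * ?\<mu>) / (?a - ?D / 2) + (?D * ?\<mu> / (?a - ?D / 2) + ?D / (?a - ?D / 2) * (?D / (4 * ?b)))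
      = ?D / (2 * ?b)"
  proof -
    have e: "?b + ?D / 2 = ?a - ?D / 2" by (simp add: field_simps)
    have "d / z * (z / c) = d / c" if "0 < z" for d z c :: real using that by simp
    from this[OF h] have "?D / (?a - ?D / 2) * ((?b + ?D / 2) / (2 * ?b)) = ?D / (2 * ?b)" unfolding e .
    moreover have "(?D / 2 - ?D * ?\<mu>) / (?a - ?D / 2) + (?D * ?\<mu> / (?a - ?D / 2) + ?D / (?a - ?D / 2) * (?D / (4 * ?b)))
      = ?D / (?a - ?D / 2) * (1 / 2 + ?D / (4 * ?b))"
    proof -
      have "(d / 2 - v) / z + (v / z + d / z * w) = d / z * (1 / 2 + w)" for d v z w :: real
        by (simp add: diff_divide_distrib distrib_left)
      then show ?thesis .
    qed
    moreover have "1 / 2 + ?D / (4 * ?b) = (?b + ?D / 2) / (2 * ?b)" using b by (simp add: field_simps)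
    ultimately show ?thesis by metis
  qed
  ultimately show ?thesis using bound2_mid by linarith
qed

text \<open>The line through the kink and the value at \<open>s = 1\<close>, with
  \<open>y = 1 / \<sigma>\<close> and \<open>\<mu> = \<kappa> * \<sigma>\<close>. For
  \<open>\<mu> * y = 1\<close> this is \<open>bound2\<close>; a smaller \<mu> is handled by
  increasing either \<mu> or \<open>y\<close>.\<close>

lemma forward_many_far:
  assumes y: "1 \<le> y" "y \<le> 2" and \<mu>: "0 \<le> \<mu>" "\<mu> * y \<le> 1"
  shows "gain_up f (m + (M - m) * \<mu>) + \<mu> * (M - m) * ((2 * y - y\<^sup>2) / m + (y - 1) / (1 - M)) \<le> B"
proof -
  let ?D = "M - m" and ?b = "1 - M"
  define h where "h t = (2 * t - t\<^sup>2) / m + (t - 1) / ?b" for t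
  have b: "0 < ?b" using M_less_1 by simp
  have D: "0 \<le> ?D" using m_le_M by simp
  \<comment> \<open>\<open>h t \<ge> 1 / (1 - M)\<close> makes the expression nondecreasing in \<open>\<mu>\<close>.\<close>
  have grow: "gain_up f (m + ?D * \<mu>) + \<mu> * ?D * h t \<le> B"
    if t: "1 \<le> t" "t \<le> 2" "\<mu> * t \<le> 1" and ht: "1 / ?b \<le> h t" for t
  proof -
    have t': "\<mu> \<le> 1 / t" using t by (simp add: field_simps)
    have "m + ?D / t \<le> M" using score_le_M[of "1 / t"] t by simp
    have "gain_up f (m + ?D * \<mu>) - gain_up f (m + ?D / t) \<le> (?D / t - ?D * \<mu>) / (1 - (m + ?D / t))"
      using gain_up_diff_le[OF f_nonneg, of "m + ?D * \<mu>" "m + ?D / t"] mult_left_mono[OF t' D]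
        \<open>m + ?D / t \<le> M\<close> M_less_1 by simp
    also have "\<dots> \<le> (?D / t - ?D * \<mu>) / ?b"
      using mult_left_mono[OF t' D] \<open>m + ?D / t \<le> M\<close> b by (intro divide_left_mono mult_pos_pos) auto
    also have "\<dots> = (?D / t - ?D * \<mu>) * (1 / ?b)" by simp
    also have "\<dots> \<le> (?D / t - ?D * \<mu>) * h t"
      using ht mult_left_mono[OF t' D] by (intro mult_left_mono) auto
    also have "\<dots> = ?D / t * h t - \<mu> * ?D * h t" by (simp add: algebra_simps)
    finally show ?thesis using bound2[OF t(1,2)] unfolding h_def[symmetric] by linarith
  qed
  have h_ge: "1 / ?b \<le> h t" if "1 \<le> t" "t \<le> 2" "m / ?b \<le> t \<or> t = 2" for t
  proof -
    have "h t - 1 / ?b = (2 - t) * (t / m - 1 / ?b)"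
      by (simp add: h_def diff_divide_distrib algebra_simps power2_eq_square)
    moreover have "0 \<le> (2 - t) * (t / m - 1 / ?b)"
    proof (cases "t = 2")
      case False
      then have "1 / ?b \<le> t / m" using that m_pos b by (simp add: field_simps)
      then show ?thesis using that by simp
    qed simp
    ultimately show ?thesis by linarith
  qed
  show ?thesis
  proof (cases "m / ?b \<le> y \<or> y = 2 \<or> \<mu> = 0")
    case True
    then show ?thesis
    proof (elim disjE)
      assume "\<mu> = 0"
      then show ?thesis using bound1[of 0] by simp
    qed (use grow[of y] h_ge[of y] assms in \<open>auto simp: h_def\<close>)
  next
    case False
    \<comment> \<open>Below \<open>m / ?b\<close> the function \<open>h\<close> increases, so
      \<open>y\<close> may be raised until \<open>\<mu> * t = 1\<close>, where \<open>bound2\<close>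
      applies, or until \<open>grow\<close> applies.\<close>
    define t where "t = min (1 / \<mu>) (min (m / ?b) 2)"
    have \<mu>0: "0 < \<mu>" using False \<mu> by simp
    have yt: "y \<le> t" "t \<le> 2" using False \<mu>0 \<mu> y by (auto simp: t_def field_simps)
    have "h t - h y = (t - y) / m * (2 - t - y) + (t - y) / ?b"
      by (simp add: h_def diff_divide_distrib add_divide_distrib algebra_simps power2_eq_square)
    also have "\<dots> = (t - y) / m * (2 - t - y + m / ?b)"
      using m_pos by (simp add: distrib_left)
    finally have "h t - h y = (t - y) / m * (2 - t - y + m / ?b)" .
    moreover have "0 \<le> (t - y) / m * (2 - t - y + m / ?b)"
      using yt False m_pos by (intro mult_nonneg_nonneg) auto
    ultimately have "h y \<le> h t" by linarith
    then have "\<mu> * ?D * h y \<le> \<mu> * ?D * h t" using \<mu> D by (intro mult_left_mono) auto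
    moreover have "gain_up f (m + ?D * \<mu>) + \<mu> * ?D * h t \<le> B"
    proof (cases "t = 1 / \<mu>")
      case True
      then have "?D / t = \<mu> * ?D" by simp
      then show ?thesis using bound2[of t] yt y unfolding h_def by (simp add: mult.commute)
    next
      case False
      then have "m / ?b \<le> t \<or> t = 2" by (auto simp: t_def min_def split: if_splits)
      moreover have "\<mu> * t \<le> 1" using \<mu>0 by (simp add: t_def min_def field_simps)
      ultimately show ?thesis using grow[of t] h_ge[of t] yt y by simp
    qed
    ultimately show ?thesis by (simp add: h_def)
  qed
qed

text \<open>The first condition controls deletion of a record at distance \<open>s\<close> from
  \<open>z\<close>, the second its retention. The majorant is affine, so averaging over
  \<open>D\<close> only replaces \<open>s\<close> by the mean \<sigma>; \<kappa> is
  \<open>n / (n + 1)\<close>.\<close>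

lemma forward_majorant:
  assumes \<kappa>: "0 \<le> \<kappa>" "\<kappa> \<le> 1" and \<sigma>: "0 \<le> \<sigma>" "\<sigma> \<le> 1"
  obtains \<alpha> \<beta> where
    "\<And>s. 0 \<le> s \<Longrightarrow> s \<le> 1 \<Longrightarrow> (M - m) * s / m \<le> \<alpha> + \<beta> * s"
    "\<And>s u. 0 \<le> s \<Longrightarrow> s \<le> 1 \<Longrightarrow> 0 \<le> u \<Longrightarrow> u \<le> 1 \<Longrightarrow> u \<le> s + \<sigma> \<Longrightarrow>
       (M - m) * (u - s) / (1 - m - (M - m) * u) \<le> \<alpha> + \<beta> * s"
    "gain_up f (m + (M - m) * (\<kappa> * \<sigma>)) + \<kappa> * (\<alpha> + \<beta> * \<sigma>) \<le> B"
proof -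
  let ?D = "M - m" and ?a = "1 - m" and ?b = "1 - M"
  define \<alpha>0 where "\<alpha>0 = ?D * \<sigma> / (?a - ?D * \<sigma>)"
  have b: "0 < ?b" using M_less_1 by simp
  have D: "0 \<le> ?D" using m_le_M by simp
  have aD: "0 < ?a - ?D * \<sigma>" using score_le_M[OF \<sigma>] b by linarith
  have \<alpha>0: "0 \<le> \<alpha>0" using D \<sigma> aD by (simp add: \<alpha>0_def)
  note result = that
  have crit: thesis
    if 1: "\<alpha>0 \<le> \<alpha>" and 2: "?D * \<sigma> / ?b \<le> \<alpha> + \<beta> * (1 - \<sigma>)" and 3: "?D / m \<le> \<alpha> + \<beta>"
      and 4: "gain_up f (m + ?D * (\<kappa> * \<sigma>)) + \<kappa> * (\<alpha> + \<beta> * \<sigma>) \<le> B" for \<alpha> \<beta>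
  proof (rule result[OF _ _ 4])
    fix s :: real assume s: "0 \<le> s" "s \<le> 1"
    have "?D * s / m = s * (?D / m)" by simp
    also have "\<dots> \<le> s * (\<alpha> + \<beta>)" using 3 s by (intro mult_left_mono)
    also have "\<dots> \<le> s * (\<alpha> + \<beta>) + (1 - s) * \<alpha>" using s 1 \<alpha>0 by simp
    finally show "?D * s / m \<le> \<alpha> + \<beta> * s" by (simp add: algebra_simps)
    fix u :: real assume u: "0 \<le> u" "u \<le> 1" "u \<le> s + \<sigma>"
    have "0 \<le> ?D / m" using D m_pos by simp
    then have "0 \<le> \<alpha> + \<beta>" using 3 by linarith
    have "?D * (u - s) / (?a + (m - M) * u) \<le> \<alpha> + \<beta> * s"
    proof (rule affine_majorant_three_points[OF _ _ D \<sigma> s u _ _ \<open>0 \<le> \<alpha> + \<beta>\<close>])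
      show "?D * \<sigma> / (?a + (m - M) * \<sigma>) \<le> \<alpha>" using 1 by (simp add: \<alpha>0_def algebra_simps)
    qed (use 2 b D in auto)
    then show "?D * (u - s) / (?a - ?D * u) \<le> \<alpha> + \<beta> * s" by (simp add: algebra_simps)
  qed
  show thesis
  \<comment> \<open>Whether the kink lies below the chord from \<open>(0, \<alpha>0)\<close> to
    \<open>(1, ?D / m)\<close>.\<close>
  proof (cases "?D * \<sigma> / ?b \<le> \<sigma> * \<alpha>0 + (1 - \<sigma>) * (?D / m)")
    case True
    show thesis
    proof (rule crit[of \<alpha>0 "?D / m - \<alpha>0"])
      show "?D * \<sigma> / ?b \<le> \<alpha>0 + (?D / m - \<alpha>0) * (1 - \<sigma>)" using True by (simp add: algebra_simps)
      show "gain_up f (m + ?D * (\<kappa> * \<sigma>)) + \<kappa> * (\<alpha>0 + (?D / m - \<alpha>0) * \<sigma>) \<le> B"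
        using forward_kink_below[OF \<kappa> \<sigma>] unfolding \<alpha>0_def[symmetric] by (simp add: algebra_simps)
    qed auto
  next
    case False
    have "\<sigma> \<noteq> 0"
    proof
      assume "\<sigma> = 0" then show False using False D m_pos by (simp add: \<alpha>0_def)
    qed
    then have \<sigma>0: "0 < \<sigma>" using \<sigma> by simp
    show thesis
    \<comment> \<open>The majorant is evaluated at \<sigma>, which lies to the left of the kink
      \<open>1 - \<sigma>\<close> exactly for \<open>\<sigma> \<le> 1 / 2\<close>. The line chosen
      is the one through the two test points around \<sigma>.\<close>
    proof (cases "\<sigma> \<le> 1 / 2")
      case True
      have kink: "\<alpha>0 + \<alpha>0 * (?D / ?b) * (1 - \<sigma>) = ?D * \<sigma> / ?b"
      proof -
        have "?b + ?D * (1 - \<sigma>) = ?a - ?D * \<sigma>" by (simp add: algebra_simps)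
        then have "1 + ?D / ?b * (1 - \<sigma>) = (?a - ?D * \<sigma>) / ?b" using b by (simp add: field_simps)
        then have "\<alpha>0 * (1 + ?D / ?b * (1 - \<sigma>)) = ?D * \<sigma> / ?b" using aD by (simp add: \<alpha>0_def)
        then show ?thesis by (simp add: algebra_simps)
      qed
      show thesis
      proof (rule crit[of \<alpha>0 "\<alpha>0 * (?D / ?b)"])
        show "?D * \<sigma> / ?b \<le> \<alpha>0 + \<alpha>0 * (?D / ?b) * (1 - \<sigma>)" using kink by simp
        have "(1 - \<sigma>) * (?D / m) \<le> (1 - \<sigma>) * (\<alpha>0 + \<alpha>0 * (?D / ?b))"
          using False kink by (simp add: algebra_simps)
        then show "?D / m \<le> \<alpha>0 + \<alpha>0 * (?D / ?b)"
          by (rule mult_left_le_imp_le) (use True in simp)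
        show "gain_up f (m + ?D * (\<kappa> * \<sigma>)) + \<kappa> * (\<alpha>0 + \<alpha>0 * (?D / ?b) * \<sigma>) \<le> B"
          using forward_few_far[OF \<kappa> \<sigma>(1) True] unfolding \<alpha>0_def[symmetric] by (simp add: algebra_simps)
      qed auto
    next
      case half: False
      define \<beta> where "\<beta> = (?D / m - ?D * \<sigma> / ?b) / \<sigma>"
      have \<beta>: "\<sigma> * \<beta> = ?D / m - ?D * \<sigma> / ?b" using \<sigma>0 by (simp add: \<beta>_def)
      show thesis
      proof (rule crit[of "?D / m - \<beta>" \<beta>])
        have "(1 - \<sigma>) * (?D / m) = ?D / m - \<sigma> * (?D / m)" by (subst left_diff_distrib) simp
        moreover have "\<sigma> * (?D / m - \<beta>) = \<sigma> * (?D / m) - \<sigma> * \<beta>" by (rule right_diff_distrib)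
        ultimately have "\<sigma> * \<alpha>0 \<le> \<sigma> * (?D / m - \<beta>)" using False \<beta> by linarith
        then show "\<alpha>0 \<le> ?D / m - \<beta>" using \<sigma>0 by simp
        show "?D * \<sigma> / ?b \<le> ?D / m - \<beta> + \<beta> * (1 - \<sigma>)" using \<beta> by (simp add: algebra_simps)
        have "?D / m - \<beta> + \<beta> * \<sigma> = \<sigma> * ?D * ((2 * (1/\<sigma>) - (1/\<sigma>)\<^sup>2) / m + (1/\<sigma> - 1) / ?b)"
        proof -
          have "d / m - (d / m - d * s / c) / s + (d / m - d * s / c) / s * s
              = s * d * ((2 * (1/s) - (1/s)\<^sup>2) / m + (1/s - 1) / c)"
            if "0 < s" "0 < c" for d s c :: real
            using that m_pos by (simp add: field_simps power2_eq_square)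
          from this[OF \<sigma>0 b] show ?thesis unfolding \<beta>_def .
        qed
        then have eq: "\<kappa> * (?D / m - \<beta> + \<beta> * \<sigma>) = (\<kappa> * \<sigma>) * ?D * ((2 * (1/\<sigma>) - (1/\<sigma>)\<^sup>2) / m + (1/\<sigma> - 1) / ?b)"
          by simp
        show "gain_up f (m + ?D * (\<kappa> * \<sigma>)) + \<kappa> * (?D / m - \<beta> + \<beta> * \<sigma>) \<le> B"
          unfolding eq using half \<sigma> \<kappa> \<sigma>0
          by (intro forward_many_far) (auto simp: field_simps)
      qed auto
    qed
  qed
qed

end

section \<open>Removing a record\<close>

text \<open>For \<open>x \<ge> 1 / 2\<close> one has
  \<open>(1 + f * x)\<^sup>2 \<ge> (1 + f / 2)\<^sup>2 \<ge> 1 + f\<close>. A lower bound on the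
  slope of \<open>gain_down\<close> thus becomes a lower bound on the gap in
  \<open>gain_gap\<close>.\<close>

lemma sq_le_of_less_ratio:
  fixes f x r :: real
  assumes "0 \<le> f" "1 / 2 \<le> x" "0 \<le> r" "r \<le> f / (1 + f * x)"
  shows "r\<^sup>2 \<le> f\<^sup>2 / (1 + f)"
proof -
  have "f / 2 \<le> f * x" using mult_left_mono[of "1/2" x f] assms by simp
  then have "1 + f \<le> (1 + f * x)\<^sup>2"
    using power_mono[of "1 + f / 2" "1 + f * x" 2] assms by (simp add: power2_eq_square algebra_simps)
      (smt (verit) mult_nonneg_nonneg)
  have "r\<^sup>2 \<le> (f / (1 + f * x))\<^sup>2" using assms by (intro power_mono)
  also have "\<dots> = f\<^sup>2 / (1 + f * x)\<^sup>2" by (simp add: power_divide)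
  also have "\<dots> \<le> f\<^sup>2 / (1 + f)"
    using \<open>1 + f \<le> _\<close> assms by (intro divide_left_mono mult_pos_pos) auto
  finally show ?thesis .
qed

text \<open>Here \<kappa> is \<open>n / (n + 1)\<close> for \<open>n = |D|\<close>, so
  \<open>2 / 3 \<le> \<kappa>\<close> means \<open>n \<ge> 2\<close>, and \<sigma> is the mean
  distance from \<open>z\<close> to \<open>D\<close>. Databases with one record are treated
  separately.\<close>

locale backward_step = suppression_bound +
  fixes \<kappa> \<sigma> :: real
  assumes \<kappa>: "2 / 3 \<le> \<kappa>" "\<kappa> \<le> 1" and \<sigma>: "0 \<le> \<sigma>" "\<sigma> \<le> 1"
begin

definition D where "D = M - m"
definition a where "a = 1 - m"
definition k where "k = D / a"
definition \<mu> where "\<mu> = \<kappa> * \<sigma>"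
definition x where "x = m + D * \<mu>"
text \<open>For \<open>\<kappa> = n / (n + 1)\<close> this is \<open>(n + k / 2) / (n + 1)\<close>,
  and \<open>k * V\<close> bounds \<open>- n * ln (1 - k / (n + 1))\<close>, the retention condition
  at \<open>s = 1\<close>.\<close>

definition V where "V = \<kappa> + (1 - \<kappa>) * (k / 2)"

lemma a_pos: "0 < a" and D_nonneg: "0 \<le> D"
  using m_pos m_le_M M_less_1 by (auto simp: a_def D_def)

lemma D_eq: "D = k * a" and k_nonneg: "0 \<le> k" and k_less_1: "k < 1"
  using a_pos D_nonneg M_less_1 by (auto simp: k_def) (auto simp: a_def D_def)

lemma M_eq: "m + D = M" and one_minus_M: "1 - M = a * (1 - k)"
  using a_pos by (auto simp: k_def algebra_simps) (auto simp: a_def D_def)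

lemma \<mu>_bounds: "0 \<le> \<mu>" "\<mu> \<le> \<sigma>" "\<mu> \<le> \<kappa>" "\<mu> \<le> 1"
proof -
  show "0 \<le> \<mu>" "\<mu> \<le> \<sigma>" "\<mu> \<le> \<kappa>"
    using \<kappa> \<sigma> by (auto simp: \<mu>_def intro: mult_left_le_one_le mult_left_le)
  then show "\<mu> \<le> 1" using \<sigma> by linarith
qed

lemma x_bounds: "m \<le> x" "x \<le> M" "0 < x" "x < 1"
proof -
  show "m \<le> x" "x \<le> M" using m_le_score[of \<mu>] score_le_M[of \<mu>] \<mu>_bounds by (auto simp: x_def D_def)
  then show "0 < x" "x < 1" using m_pos M_less_1 by auto
qed

lemma bound1_x: "gain_up f x + \<mu> * (D / m) + (1 - \<mu>) * \<mu> * (D / (1 - x)) \<le> B"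
proof -
  have "1 - m - (M - m) * \<mu> = 1 - x" "m + (M - m) * \<mu> = x" by (simp_all add: x_def D_def)
  from bound1[of \<mu>, unfolded this] show ?thesis using \<mu>_bounds by (simp add: D_def)
qed

lemma V_le_1: "V \<le> 1"
proof -
  have "(1 - \<kappa>) * (k / 2) \<le> (1 - \<kappa>) * 1" using \<kappa> k_less_1 by (intro mult_left_mono) auto
  then show ?thesis by (simp add: V_def)
qed

lemma V_nonneg: "0 \<le> V"
  using \<kappa> k_nonneg by (simp add: V_def)

lemma half_ratio: "D / (2 * (1 - M)) = k / (2 * (1 - k))"
  using a_pos k_less_1 unfolding D_eq one_minus_M by simp

text \<open>For \<open>k \<ge> 1 / 2\<close> the term \<open>k / (2 * (1 - k))\<close> of
  \<open>bound2_mid\<close> is at least \<open>k\<close>. If \<open>\<mu> \<ge> 1 / 2\<close>, the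
  sum of the two chord terms is at most \<open>k\<close>; otherwise the deletion probability is
  moved to the midpoint.\<close>

lemma backward_large_k:
  assumes k: "1 / 2 \<le> k" and m: "4 / 9 \<le> m"
  shows "gain_down f x + ((1 - \<sigma>) * (D * \<mu> / x) + \<sigma> * (k * V)) \<le> B"
proof -
  have mid: "gain_up f (m + D / 2) + k / (2 * (1 - k)) \<le> B"
    using bound2_mid half_ratio by (simp add: D_def)
  have Da: "a / 2 \<le> D" unfolding D_eq using mult_right_mono[OF k, of a] a_pos by simp
  show ?thesis
  proof (cases "1 / 2 \<le> \<mu>")
    case True
    have half: "D / 2 \<le> D * \<mu>" using mult_left_mono[OF True D_nonneg] by simp
    have "a * \<mu> \<le> a" using mult_left_mono[OF \<mu>_bounds(4), of a] a_pos by simp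
    then have "a * \<mu> \<le> x" using half Da m x_def a_def by linarith
    then have "D * \<mu> / x \<le> k"
      using mult_left_mono[of "a * \<mu>" x k] k_nonneg x_bounds by (simp add: D_eq field_simps)
    then have "(1 - \<sigma>) * (D * \<mu> / x) + \<sigma> * (k * V) \<le> (1 - \<sigma>) * k + \<sigma> * (k * 1)"
      using \<sigma> V_le_1 k_nonneg by (intro add_mono mult_left_mono) auto
    also have "\<dots> = k" by (simp add: algebra_simps)
    also have "\<dots> \<le> k / (2 * (1 - k))"
      using k k_less_1 by (simp add: le_divide_eq_1 field_simps)
    finally have 1: "(1 - \<sigma>) * (D * \<mu> / x) + \<sigma> * (k * V) \<le> k / (2 * (1 - k))" .
    have "gain_down f x \<le> gain_up f x" using f_nonneg x_bounds by (intro gain_down_le_up) auto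
    also have "\<dots> \<le> gain_up f (m + D / 2)"
      using f_nonneg x_bounds half by (intro gain_up_antimono) (auto simp: x_def)
    finally show ?thesis using mid 1 by linarith
  next
    case False
    have h: "0 < 1 - k / 2" using k_less_1 by simp
    have "gain_down f x \<le> gain_up f x" using f_nonneg x_bounds by (intro gain_down_le_up) auto
    also have "gain_up f x - gain_up f (m + D / 2) \<le> (m + D / 2 - x) / (1 - (m + D / 2))"
      using f_nonneg False mult_left_mono[of \<mu> "1/2" D] D_nonneg M_less_1 M_eq
      by (intro gain_up_diff_le) (auto simp: x_def)
    also have "m + D / 2 - x = a * (k * (1 / 2 - \<mu>))" by (simp add: x_def D_eq algebra_simps)
    also have "1 - (m + D / 2) = a * (1 - k / 2)" by (simp add: D_eq algebra_simps) (simp add: a_def)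
    finally have g: "gain_down f x - gain_up f (m + D / 2) \<le> k * ((1 / 2 - \<mu>) / (1 - k / 2))"
      using a_pos by simp
    \<comment> \<open>The constant is \<open>1 / 4 * (5 / 4)\<close>, from
      \<open>(1 - \<mu>) * \<mu> \<le> 1 / 4\<close> and, by \<open>m \<ge> 4 / 9\<close>,
      \<open>a / x \<le> 5 / 4\<close>.\<close>
    have "(1 - \<sigma>) * (D * \<mu> / x) \<le> k * (5 / 16)"
    proof -
      have "a / x \<le> 5 / 4" using x_bounds m by (simp add: a_def field_simps)
      have "(1 - \<sigma>) * \<mu> \<le> (1 - \<mu>) * \<mu>" using \<mu>_bounds by (intro mult_right_mono) auto
      also have "\<dots> = 1 / 4 - (1 / 2 - \<mu>)\<^sup>2" by (simp add: power2_eq_square algebra_simps)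
      finally have "(1 - \<sigma>) * \<mu> \<le> 1 / 4" by (smt (verit) zero_le_power2)
      have "(1 - \<sigma>) * (D * \<mu> / x) = k * (((1 - \<sigma>) * \<mu>) * (a / x))" by (simp add: D_eq)
      also have "\<dots> \<le> k * (1 / 4 * (5 / 4))"
        using \<open>a / x \<le> 5 / 4\<close> \<open>(1 - \<sigma>) * \<mu> \<le> 1 / 4\<close> k_nonneg a_pos x_bounds
        by (intro mult_left_mono mult_mono) auto
      finally show ?thesis by simp
    qed
    moreover have "\<sigma> * (k * V) \<le> k * (\<mu> / (1 - k / 2))"
    proof -
      have "V * (1 - k / 2) = \<kappa> - (2 * \<kappa> - 1) * k / 2 - (1 - \<kappa>) * (k\<^sup>2 / 4)"
        by (simp add: V_def field_simps power2_eq_square)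
      moreover have "0 \<le> (2 * \<kappa> - 1) * k / 2" "0 \<le> (1 - \<kappa>) * (k\<^sup>2 / 4)" using \<kappa> k_nonneg by auto
      ultimately have "V * (1 - k / 2) \<le> \<kappa>" by linarith
      then have "V \<le> \<kappa> / (1 - k / 2)" using h by (simp add: pos_le_divide_eq)
      then have "k * \<sigma> * V \<le> k * \<sigma> * (\<kappa> / (1 - k / 2))"
        using k_nonneg \<sigma> by (intro mult_left_mono) auto
      then show ?thesis by (simp add: \<mu>_def mult_ac)
    qed
    moreover have "k * ((1 / 2 - \<mu>) / (1 - k / 2)) + k * (\<mu> / (1 - k / 2)) = k * (1 / (2 - k))"
    proof -
      have "(1 / 2 - \<mu>) / (1 - k / 2) + \<mu> / (1 - k / 2) = (1 / 2) / (1 - k / 2)"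
        by (simp add: diff_divide_distrib)
      also have "\<dots> = 1 / (2 - k)" using k_less_1 by (simp add: field_simps)
      finally have e: "(1 / 2 - \<mu>) / (1 - k / 2) + \<mu> / (1 - k / 2) = 1 / (2 - k)" .
      show ?thesis by (subst distrib_left[symmetric]) (simp only: e)
    qed
    moreover have "k * (1 / (2 - k)) + k * (5 / 16) \<le> k / (2 * (1 - k))"
    proof -
      have "0 \<le> (k - 1 / 2) * (1 - k)" using k k_less_1 by simp
      then have "k\<^sup>2 \<le> 3 / 2 * k - 1 / 2" by (simp add: power2_eq_square field_simps)
      then have *: "10 * (1 - k) * (2 - k) \<le> 16 * k"
        using k by (simp add: power2_eq_square algebra_simps)
      have "1 / (2 * (1 - k)) - 1 / (2 - k) = k / (2 * (1 - k) * (2 - k))"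
        using k_less_1 by (simp add: field_simps)
      moreover have pos: "0 < 2 * (1 - k) * (2 - k)" using k_less_1 by simp
      have "5 / 16 \<le> k / (2 * (1 - k) * (2 - k))"
        unfolding pos_le_divide_eq[OF pos] using * by (simp add: algebra_simps)
      ultimately have "1 / (2 - k) + 5 / 16 \<le> 1 / (2 * (1 - k))" by linarith
      then have "k * (1 / (2 - k) + 5 / 16) \<le> k * (1 / (2 * (1 - k)))"
        using k_nonneg by (rule mult_left_mono)
      then show ?thesis by (simp add: distrib_left)
    qed
    ultimately show ?thesis using g mid by linarith
  qed
qed

text \<open>The comparison is with \<open>l1\<close> at \<open>p = \<sigma>\<close> instead of
  \<mu>: raising \<open>x\<close> to \<open>m + D * \<sigma>\<close> costs at most
  \<open>(y - x) / x\<close>, and all remaining terms share the factor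
  \<open>D * \<sigma>\<close>.\<close>

lemma backward_small_m:
  assumes m: "m \<le> 1 / 2" and alt: "m \<le> 4 / 9 \<or> k \<le> 1 / 2"
  shows "gain_down f x + ((1 - \<sigma>) * (D * \<mu> / x) + \<sigma> * (k * V)) \<le> B"
proof -
  define y where "y = m + D * \<sigma>"
  have xy: "x \<le> y" unfolding x_def y_def using \<mu>_bounds D_nonneg by (simp add: mult_left_mono)
  have y: "0 \<le> y" "y \<le> M" "1 - y = a - D * \<sigma>" "0 < 1 - y"
    using score_le_M[OF \<sigma>] x_bounds xy M_less_1 by (auto simp: y_def a_def D_def)
  have key: "V * (m * x) \<le> \<kappa> * (a * M)"
    using alt
  proof
    assume m': "m \<le> 4 / 9"
    have "(1 - \<kappa>) * (k / 2) \<le> 1 / 3 * (1 / 2)" using \<kappa> k_less_1 k_nonneg by (intro mult_mono) auto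
    then have "V \<le> 5 / 4 * \<kappa>" using \<kappa> by (simp add: V_def)
    moreover have "m \<le> 4 / 5 * a" using m' by (simp add: a_def)
    ultimately have "V * (m * x) \<le> 5 / 4 * \<kappa> * (4 / 5 * a * M)"
      using V_nonneg m_pos x_bounds \<kappa> a_pos by (intro mult_mono) auto
    then show ?thesis by (simp add: mult_ac)
  next
    assume k2: "k \<le> 1 / 2"
    have ma: "m \<le> a" using m by (simp add: a_def)
    have "x \<le> m + k * a * \<kappa>" using \<mu>_bounds D_nonneg by (simp add: x_def D_eq[symmetric] mult_left_mono)
    then have "V * (m * x) \<le> V * (m * (m + k * a * \<kappa>))"
      using V_nonneg m_pos by (intro mult_left_mono) auto
    also have "\<dots> \<le> \<kappa> * (a * (m + k * a))"
    proof -
      define r where "r = k * m"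
      have r: "0 \<le> r" "r * m \<le> r * a" using ma k_nonneg m_pos by (auto simp: r_def intro: mult_left_mono)
      have 1: "\<kappa> * (m * m) \<le> \<kappa> * (a * m)" using ma m_pos \<kappa> by (intro mult_left_mono) auto
      have 2: "\<kappa> * (r * a) \<le> \<kappa> * (k * a * a)" using ma k_nonneg a_pos \<kappa> by (auto simp: r_def intro!: mult_left_mono mult_mono)
      \<comment> \<open>Here \<open>\<kappa> \<ge> 2 / 3\<close> enters. With the
        \<open>1 / 4\<close> from \<open>4\<close> the coefficients of \<open>r * a\<close> add up
        to \<open>\<kappa>\<^sup>2 + (3 / 4 + 1 / 4) * (1 - \<kappa>) * \<kappa> =
        \<kappa>\<close>.\<close>
      have 3: "(1 - \<kappa>) / 2 * (r * m) \<le> 3 / 4 * (1 - \<kappa>) * \<kappa> * (r * a)"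
      proof -
        have "(1 - \<kappa>) * (1 / 2) \<le> (1 - \<kappa>) * (3 / 4 * \<kappa>)" using \<kappa> by (intro mult_left_mono) auto
        then have "(1 - \<kappa>) * (1 / 2) * (r * m) \<le> (1 - \<kappa>) * (3 / 4 * \<kappa>) * (r * a)"
          by (rule mult_mono[OF _ r(2)]) (use r(1) \<kappa> m_pos in auto)
        then show ?thesis by (simp add: mult_ac)
      qed
      have 4: "(1 - \<kappa>) / 2 * k * (\<kappa> * (r * a)) \<le> (1 - \<kappa>) / 2 * (1 / 2) * (\<kappa> * (r * a))"
        using k2 \<kappa> r a_pos by (intro mult_right_mono mult_left_mono) auto
      have "V * (m * (m + k * a * \<kappa>))
          = \<kappa> * (m * m) + \<kappa> * \<kappa> * (r * a) + (1 - \<kappa>) / 2 * (r * m) + (1 - \<kappa>) / 2 * k * (\<kappa> * (r * a))"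
        by (simp add: V_def r_def algebra_simps)
      also have "\<dots> \<le> \<kappa> * (a * m) + \<kappa> * \<kappa> * (r * a) + 3 / 4 * (1 - \<kappa>) * \<kappa> * (r * a)
          + (1 - \<kappa>) / 2 * (1 / 2) * (\<kappa> * (r * a))"
        using 1 3 4 by linarith
      also have "\<dots> = \<kappa> * (a * m) + \<kappa> * (r * a)" by (simp add: field_simps)
      also have "\<dots> \<le> \<kappa> * (a * m) + \<kappa> * (k * a * a)" using 2 by simp
      finally show ?thesis by (simp add: algebra_simps)
    qed
    finally show ?thesis unfolding D_eq[symmetric] M_eq .
  qed
  \<comment> \<open>The required inequality without the factor \<open>D * \<sigma>\<close>. As
    \<open>1 / m - (1 - \<mu>) / x = \<mu> * M / (m * x)\<close> and \<open>V \<le> 1\<close>, it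
    follows from \<open>key\<close>.\<close>
  have core: "(1 - \<mu>) / x + V / a \<le> 1 / m + (1 - \<sigma>) / (a - D * \<sigma>)"
  proof -
    have "1 / m - (1 - \<mu>) / x = (x - (1 - \<mu>) * m) / (m * x)"
      using m_pos x_bounds by (simp add: field_simps)
    also have "x - (1 - \<mu>) * m = \<mu> * M" by (simp add: x_def D_def algebra_simps)
    finally have e: "1 / m - (1 - \<mu>) / x = \<mu> * M / (m * x)" .
    have "(V - 1) * (1 - \<sigma>) \<le> 0" using V_le_1 \<sigma> by (simp add: mult_nonpos_nonneg)
    then have "V \<le> (1 - \<sigma>) + \<sigma> * V" by (simp add: algebra_simps)
    then have "V / a \<le> (1 - \<sigma>) / a + \<sigma> * (V / a)"
      using divide_right_mono[of V "(1 - \<sigma>) + \<sigma> * V" a] a_pos by (simp add: add_divide_distrib)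
    moreover have "V / a \<le> \<kappa> * M / (m * x)"
      using key a_pos m_pos x_bounds by (intro divide_le_divide_cross) (auto simp: mult_ac)
    then have "\<sigma> * (V / a) \<le> \<sigma> * (\<kappa> * M / (m * x))" using \<sigma> by (intro mult_left_mono)
    then have "\<sigma> * (V / a) \<le> \<mu> * M / (m * x)" by (simp add: \<mu>_def mult_ac)
    moreover have "(1 - \<sigma>) / a \<le> (1 - \<sigma>) / (a - D * \<sigma>)"
      using \<sigma> D_nonneg y a_pos by (intro divide_left_mono mult_pos_pos) auto
    ultimately show ?thesis using e by linarith
  qed
  have "gain_down f x - gain_down f y \<le> (y - x) * (f / (1 + f * x))"
    using f_nonneg x_bounds xy by (intro gain_down_diff_le) auto
  also have "\<dots> \<le> (y - x) * (1 / x)"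
    using f_nonneg x_bounds xy
    by (intro mult_left_mono divide_le_divide_cross add_pos_nonneg) auto
  finally have "gain_down f x - gain_down f y \<le> (y - x) * (1 / x)" .
  moreover have "gain_down f y \<le> gain_up f y"
    using f_nonneg y M_less_1 by (intro gain_down_le_up) auto
  moreover have "gain_up f y + \<sigma> * (D / m) + (1 - \<sigma>) * \<sigma> * (D / (a - D * \<sigma>)) \<le> B"
    using bound1[OF \<sigma>] by (simp add: y_def D_def a_def)
  moreover have "(y - x) * (1 / x) + ((1 - \<sigma>) * (D * \<mu> / x) + \<sigma> * (k * V))
      \<le> \<sigma> * (D / m) + (1 - \<sigma>) * \<sigma> * (D / (a - D * \<sigma>))"
  proof -
    have "D * \<sigma> * ((1 - \<mu>) / x + V / a) \<le> D * \<sigma> * (1 / m + (1 - \<sigma>) / (a - D * \<sigma>))"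
      using core D_nonneg \<sigma> by (intro mult_left_mono) auto
    moreover have "(y - x) * (1 / x) + ((1 - \<sigma>) * (D * \<mu> / x) + \<sigma> * (k * V)) = D * \<sigma> * ((1 - \<mu>) / x + V / a)"
    proof -
      have "(y - x) * (1 / x) + (1 - \<sigma>) * (D * \<mu> / x) = ((y - x) + (1 - \<sigma>) * (D * \<mu>)) / x"
        by (simp add: add_divide_distrib)
      also have "(y - x) + (1 - \<sigma>) * (D * \<mu>) = D * \<sigma> * (1 - \<mu>)"
        by (simp add: x_def y_def \<mu>_def algebra_simps)
      finally have "(y - x) * (1 / x) + (1 - \<sigma>) * (D * \<mu> / x) = D * \<sigma> * (1 - \<mu>) / x" .
      moreover have "\<sigma> * (k * V) = D * \<sigma> * V / a" by (simp add: k_def)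
      moreover have "D * \<sigma> * ((1 - \<mu>) / x + V / a) = D * \<sigma> * (1 - \<mu>) / x + D * \<sigma> * V / a"
        by (simp add: distrib_left)
      ultimately show ?thesis by linarith
    qed
    ultimately show ?thesis by (simp add: distrib_left mult_ac)
  qed
  ultimately show ?thesis by linarith
qed

text \<open>What the chord exceeds the terms of \<open>l1\<close> at \<open>p = \<mu>\<close> by,
  gains left aside. For \<open>\<kappa> = n / (n + 1)\<close> the parameter \<omega> is
  \<open>1 / n\<close>, so the last summand is a correction for small databases.\<close>

lemma backward_excess_l1:
  defines "\<omega> \<equiv> (1 - \<kappa>) / \<kappa>"
  shows "(1 - \<sigma>) * (D * \<mu> / x) + \<sigma> * (k * V) - \<mu> * (D / m) - (1 - \<mu>) * \<mu> * (D / (1 - x))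
    \<le> D * \<mu>\<^sup>2 * (1 / a - 1 / m) + D * \<mu> * \<omega> * (k / (2 * a) - \<mu> / x)"
proof -
  have \<sigma>_eq: "\<sigma> = \<mu> * (1 + \<omega>)" and V_eq: "\<sigma> * V = \<mu> * (1 + \<omega> * (k / 2))"
    using \<kappa> by (auto simp: \<omega>_def \<mu>_def V_def field_simps)
  have gen: "(1 - \<mu> * (1 + \<omega>)) * (\<mu> * ix) + \<mu> * (1 + \<omega> * (k / 2)) * ia - \<mu> * im - (1 - \<mu>) * \<mu> * iy
      - (\<mu>\<^sup>2 * (ia - im) + \<mu> * \<omega> * (k / 2 * ia - \<mu> * ix))
      = \<mu> * (1 - \<mu>) * ((ix - im) + (ia - iy))" for ix ia im iy :: real
    by (simp add: algebra_simps power2_eq_square)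
  have "1 / x \<le> 1 / m" using m_pos x_bounds by (simp add: frac_le)
  moreover have "1 / a \<le> 1 / (1 - x)" using x_bounds by (simp add: frac_le a_def)
  ultimately have "\<mu> * (1 - \<mu>) * ((1 / x - 1 / m) + (1 / a - 1 / (1 - x))) \<le> 0"
    using \<mu>_bounds by (intro mult_nonneg_nonpos mult_nonneg_nonneg) auto
  with gen[of "1 / x" "1 / a" "1 / m" "1 / (1 - x)"]
  have "(1 - \<mu> * (1 + \<omega>)) * (\<mu> * (1 / x)) + \<mu> * (1 + \<omega> * (k / 2)) * (1 / a) - \<mu> * (1 / m) - (1 - \<mu>) * \<mu> * (1 / (1 - x))
      \<le> \<mu>\<^sup>2 * (1 / a - 1 / m) + \<mu> * \<omega> * (k / 2 * (1 / a) - \<mu> * (1 / x))" by linarith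
  then have "D * ((1 - \<mu> * (1 + \<omega>)) * (\<mu> * (1 / x)) + \<mu> * (1 + \<omega> * (k / 2)) * (1 / a) - \<mu> * (1 / m) - (1 - \<mu>) * \<mu> * (1 / (1 - x)))
      \<le> D * (\<mu>\<^sup>2 * (1 / a - 1 / m) + \<mu> * \<omega> * (k / 2 * (1 / a) - \<mu> * (1 / x)))"
    using D_nonneg by (rule mult_left_mono)
  moreover have "D * ((1 - \<mu> * (1 + \<omega>)) * (\<mu> * (1 / x)) + \<mu> * (1 + \<omega> * (k / 2)) * (1 / a) - \<mu> * (1 / m) - (1 - \<mu>) * \<mu> * (1 / (1 - x)))
      = (1 - \<sigma>) * (D * \<mu> / x) + \<sigma> * (k * V) - \<mu> * (D / m) - (1 - \<mu>) * \<mu> * (D / (1 - x))"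
  proof -
    have e: "D * (\<mu> * (1 + \<omega> * (k / 2)) * (1 / a)) = \<sigma> * (k * V)"
      unfolding V_eq[symmetric] by (simp add: k_def)
    have "d * ((1 - s) * (u * (1 / p)) + t - u * (1 / q) - (1 - u) * u * (1 / r))
        = (1 - s) * (d * u / p) + d * t - u * (d / q) - (1 - u) * u * (d / r)" for d s u t p q r :: real
      by (simp add: diff_divide_distrib left_diff_distrib right_diff_distrib distrib_left mult_ac)
    from this[of D \<sigma> \<mu> x "\<mu> * (1 + \<omega> * (k / 2)) * (1 / a)" m "1 - x", unfolded e]
    show ?thesis unfolding \<sigma>_eq[symmetric] .
  qed
  moreover have "D * (\<mu>\<^sup>2 * (1 / a - 1 / m) + \<mu> * \<omega> * (k / 2 * (1 / a) - \<mu> * (1 / x)))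
      = D * \<mu>\<^sup>2 * (1 / a - 1 / m) + D * \<mu> * \<omega> * (k / (2 * a) - \<mu> / x)"
    by (simp add: distrib_left mult_ac)
  ultimately show ?thesis by linarith
qed

text \<open>If \<open>f\<close> is so large that the comparison with \<open>l3\<close> fails, then the gap between
  \<open>gain_up\<close> and \<open>gain_down\<close> at \<open>x\<close> pays for the comparison with \<open>l1\<close>.\<close>
lemma backward_small_k:
  assumes k: "k \<le> 1 / 2" and m: "1 / 2 \<le> m"
  shows "gain_down f x + ((1 - \<sigma>) * (D * \<mu> / x) + \<sigma> * (k * V)) \<le> B"
proof -
  define e where "e = f / (1 + f * x)"
  define R where "R = 1 / a - \<sigma> / x"
  define \<omega> where "\<omega> = (1 - \<kappa>) / \<kappa>"
  define Q where "Q = D * \<mu>\<^sup>2 * (1 / a - 1 / m)"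
  define z where "z = x * (1 - x) * (f\<^sup>2 / (1 + f))"
  have am: "a \<le> 1 / 2" "a \<le> m" using m by (auto simp: a_def)
  have fx: "0 < 1 + f * x" using f_nonneg x_bounds by (intro add_pos_nonneg) auto
  have e0: "0 \<le> e" using f_nonneg fx by (simp add: e_def)
  have ex: "e * x < 1" using fx by (simp add: e_def)
  have \<omega>: "0 \<le> \<omega>" "\<omega> \<le> 1 / 2" "\<sigma> = \<mu> * (1 + \<omega>)"
    using \<kappa> by (auto simp: \<omega>_def \<mu>_def field_simps)
  have one_minus: "1 - \<mu> = (1 - \<kappa>) + \<kappa> * (1 - \<sigma>)" by (simp add: \<mu>_def algebra_simps)
  have z0: "0 \<le> z" using x_bounds f_nonneg by (simp add: z_def)
  have gap: "gain_up f x - gain_down f x = ln (1 + z)"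
    unfolding z_def using x_bounds f_nonneg by (intro gain_gap) auto
  have Q_eq: "Q = k * \<mu>\<^sup>2 * ((m - a) / m)"
    using a_pos m_pos by (simp add: Q_def D_eq field_simps)
  have l1: ?thesis if "Q + D * \<mu> * \<omega> * (k / (2 * a) - \<mu> / x) \<le> ln (1 + z)"
  proof -
    show ?thesis using bound1_x backward_excess_l1 gap that unfolding Q_def \<omega>_def by linarith
  qed
  show ?thesis
  \<comment> \<open>The comparison with \<open>l3\<close>, after division by \<open>D\<close>:
    moving \<open>x\<close> up to \<open>M\<close> costs at most \<open>D * (1 - \<mu>) * e\<close>,
    and the right-hand side is at most what the chord leaves below \<open>1 / a\<close>.\<close>
  proof (cases "(1 - \<mu>) * e \<le> (1 - \<kappa>) * ((1 - k / 2) / a) + \<kappa> * (1 - \<sigma>) * R")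
    case True
    have "gain_down f x - gain_down f M \<le> (M - x) * e"
      unfolding e_def using f_nonneg x_bounds by (intro gain_down_diff_le) auto
    also have "M - x = D * (1 - \<mu>)" by (simp add: x_def D_def algebra_simps)
    finally have 1: "gain_down f x - gain_down f M \<le> D * ((1 - \<mu>) * e)" by (simp add: mult_ac)
    have gen: "(1 - \<sigma>) * (\<mu> * ix) + \<sigma> * (V * ia) - ia
        = - (\<kappa> * (1 - \<sigma>) * (ia - \<sigma> * ix) + (1 - \<kappa>) * ((1 - \<sigma> * (k / 2)) * ia))" for ix ia :: real
      by (simp add: \<mu>_def V_def algebra_simps)
    have "\<sigma> * (k / 2) \<le> k / 2" using \<sigma> k_nonneg by (intro mult_left_le_one_le) auto
    then have "(1 - \<kappa>) * ((1 - k / 2) * (1 / a)) \<le> (1 - \<kappa>) * ((1 - \<sigma> * (k / 2)) * (1 / a))"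
      using \<kappa> a_pos by (intro mult_left_mono mult_right_mono) auto
    with gen[of "1 / x" "1 / a"]
    have "(1 - \<sigma>) * (\<mu> * (1 / x)) + \<sigma> * (V * (1 / a)) - 1 / a
        \<le> - (\<kappa> * (1 - \<sigma>) * R + (1 - \<kappa>) * ((1 - k / 2) * (1 / a)))"
      unfolding R_def by simp
    then have "(1 - \<mu>) * e + ((1 - \<sigma>) * (\<mu> * (1 / x)) + \<sigma> * (V * (1 / a)) - 1 / a) \<le> 0"
      using True by simp
    then have "D * ((1 - \<mu>) * e + ((1 - \<sigma>) * (\<mu> * (1 / x)) + \<sigma> * (V * (1 / a)) - 1 / a)) \<le> 0"
      using D_nonneg by (simp add: mult_nonneg_nonpos)
    then have "D * ((1 - \<mu>) * e) + ((1 - \<sigma>) * (D * \<mu> / x) + \<sigma> * (k * V)) \<le> D / a"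
      by (simp add: distrib_left right_diff_distrib k_def mult_ac)
    then show ?thesis using 1 bound3 by (simp add: D_def a_def)
  next
    case False
    \<comment> \<open>The weights \<open>1 - \<kappa>\<close> and
      \<open>\<kappa> * (1 - \<sigma>)\<close> sum to \<open>1 - \<mu>\<close>, so failure of the
      test puts \<open>e\<close> above the smaller of the two weighted values.\<close>
    have R_low: "r < e" if "r \<le> (1 - k / 2) / a" "r \<le> R" for r
    proof -
      have "(1 - \<mu>) * r \<le> (1 - \<kappa>) * ((1 - k / 2) / a) + \<kappa> * (1 - \<sigma>) * R"
        unfolding one_minus distrib_right using that \<kappa> \<sigma> by (intro add_mono mult_left_mono) auto
      then have "(1 - \<mu>) * r < (1 - \<mu>) * e" using False by linarith
      then show ?thesis using \<mu>_bounds by (simp add: mult_less_cancel_left)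
    qed
    have z_low: "x * (1 - x) * r\<^sup>2 \<le> z" if "0 \<le> r" "r \<le> e" for r
      unfolding z_def using that sq_le_of_less_ratio[of f x r] f_nonneg x_bounds m
      by (intro mult_left_mono) (auto simp: e_def)
    show ?thesis
    \<comment> \<open>The sign of the correction term in \<open>backward_excess_l1\<close>.\<close>
    proof (cases "k / (2 * a) \<le> \<mu> / x")
      case True
      have "\<mu> / x \<le> \<sigma> / x" using \<mu>_bounds x_bounds by (simp add: divide_right_mono)
      then have "R \<le> (1 - k / 2) / a" using True by (simp add: R_def diff_divide_distrib)
      then have Re: "R < e" using R_low by simp
      \<comment> \<open>This is \<open>x - a\<close>, the numerator of \<open>R\<close> with
        \<sigma> replaced by \<open>1\<close>. The inequality
        \<open>4 * (m - a) * (D * \<mu>) \<le> w\<^sup>2\<close> then turns the bound on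
        \<open>z\<close> into a multiple of \<open>Q\<close>.\<close>
      define w where "w = m - a + D * \<mu>"
      have w0: "0 \<le> w" using am D_nonneg \<mu>_bounds by (simp add: w_def)
      have "a * \<sigma> \<le> a" using \<sigma> a_pos by (simp add: mult_left_le)
      then have "w \<le> x - a * \<sigma>" by (simp add: w_def x_def)
      moreover have R_eq: "R = (x - a * \<sigma>) / (a * x)"
        using a_pos x_bounds by (simp add: R_def field_simps)
      ultimately have Rw: "w / (a * x) \<le> R" using a_pos x_bounds by (simp add: divide_right_mono)
      have "0 \<le> w / (a * x)" using w0 a_pos x_bounds by simp
      then have "x * (1 - x) * (w / (a * x))\<^sup>2 \<le> z" using z_low Rw Re by simp
      moreover have "4 / 3 * Q \<le> x * (1 - x) * (w / (a * x))\<^sup>2"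
      proof -
        have w4: "4 * (m - a) * (D * \<mu>) \<le> w\<^sup>2"
        proof -
          have "w\<^sup>2 - 4 * (m - a) * (D * \<mu>) = (m - a - D * \<mu>)\<^sup>2"
            by (simp add: w_def power2_eq_square algebra_simps)
          then show ?thesis by (smt (verit) zero_le_power2)
        qed
        have "a * (1 / 2) \<le> a * (1 - k)" using k a_pos by (intro mult_left_mono) auto
        then have 1: "a / 2 \<le> 1 - x" using x_bounds one_minus_M by simp
        have "k * a \<le> 1 / 2 * a" using k a_pos by (intro mult_right_mono) auto
        then have 2: "x \<le> 3 / 2 * m" using x_bounds m M_eq D_eq a_def by linarith
        have "(1 / 2) / (3 / 2 * m) \<le> ((1 - x) / a) / x"
        proof (rule frac_le)
          show "1 / 2 \<le> (1 - x) / a" using 1 a_pos by (simp add: field_simps)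
          then show "0 \<le> (1 - x) / a" by linarith
        qed (use 2 x_bounds in auto)
        then have "1 / (3 * m) \<le> (1 - x) / (a * x)" by simp
        moreover have "\<mu> * (1 / (3 * m)) \<le> 1 * (1 / (3 * m))"
          using \<mu>_bounds m_pos by (intro mult_right_mono) auto
        ultimately have 3: "\<mu> / (3 * m) \<le> (1 - x) / (a * x)" by simp
        have "4 / 3 * Q = (\<mu> / (3 * m)) * (4 * (m - a) * (D * \<mu>) / a)"
          using a_pos m_pos by (simp add: Q_def field_simps power2_eq_square)
        also have "\<dots> \<le> ((1 - x) / (a * x)) * (w\<^sup>2 / a)"
          using 3 w4 a_pos x_bounds am D_nonneg \<mu>_bounds
          by (intro mult_mono divide_right_mono) auto
        also have "\<dots> = x * (1 - x) * (w / (a * x))\<^sup>2"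
          using a_pos x_bounds by (simp add: field_simps power2_eq_square)
        finally show ?thesis .
      qed
      ultimately have zQ: "4 / 3 * Q \<le> z" by linarith
      have Q0: "0 \<le> Q" using k_nonneg am m_pos by (simp add: Q_eq)
      \<comment> \<open>From \<open>R < e\<close> and \<open>e * x < 1\<close> one gets
        \<open>x < 2 * a\<close>, hence \<open>m \<le> 2 / 3\<close>. Together with
        \<open>4 / 3 * Q \<le> z\<close> this yields \<open>Q * (1 + z) \<le> z\<close>.\<close>
      have Q4: "Q \<le> 1 / 4"
      proof -
        have "R * x < 1" using mult_right_mono[of R e x] Re ex x_bounds by linarith
        moreover have "R * x = (x - a * \<sigma>) / a" using x_bounds by (simp add: R_eq)
        ultimately have "x - a * \<sigma> < a" using a_pos by simp
        then have "m \<le> 2 / 3" using x_bounds \<open>a * \<sigma> \<le> a\<close> a_def by linarith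
        then have h1: "(m - a) / m \<le> 1 / 2" using m_pos by (simp add: a_def field_simps)
        have h2: "k * \<mu>\<^sup>2 \<le> 1 / 2 * 1"
          using k k_nonneg \<mu>_bounds by (intro mult_mono) (auto intro: power_le_one)
        have "(k * \<mu>\<^sup>2) * ((m - a) / m) \<le> (1 / 2 * 1) * (1 / 2)"
          by (rule mult_mono[OF h2 h1]) (use am m_pos in auto)
        then show ?thesis by (simp add: Q_eq)
      qed
      have "Q \<le> z / (1 + z)"
      proof -
        have "Q * z \<le> 1 / 4 * z" using Q4 z0 by (rule mult_right_mono)
        then have "Q * (1 + z) \<le> z" using zQ by (simp add: algebra_simps)
        then show ?thesis using z0 by (simp add: pos_le_divide_eq)
      qed
      also have "\<dots> \<le> ln (1 + z)" by (rule ln_ge_frac[OF z0])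
      finally have "Q \<le> ln (1 + z)" .
      moreover have "D * \<mu> * \<omega> * (k / (2 * a) - \<mu> / x) \<le> 0"
        using True D_nonneg \<mu>_bounds \<omega> by (intro mult_nonneg_nonpos) auto
      ultimately show ?thesis using l1 by linarith
    next
      \<comment> \<open>The correction may be positive, but \<mu> is small and \<open>R\<close> is
        at least \<open>5 / (8 * a)\<close>. So \<open>e\<close> is large, and
        \<open>e * x < 1\<close> keeps \<open>x\<close> away from \<open>1\<close>; then
        \<open>ln (1 + z) \<ge> 5 / 37\<close>, while the excess is at most
        \<open>21 / 200\<close>.\<close>
      case small: False
      have "\<sigma> / x = (1 + \<omega>) * (\<mu> / x)"
        using arg_cong[OF \<omega>(3), of "\<lambda>t. t / x"] by (simp only: times_divide_eq_right mult.commute)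
      also have "\<dots> \<le> 3 / 2 * (k / (2 * a))"
        using small \<omega> \<mu>_bounds x_bounds by (intro mult_mono) auto
      finally have "1 / a - 3 / 4 * k / a \<le> R" by (simp add: R_def)
      moreover have "5 / 8 / a \<le> (1 - 3 / 4 * k) / a" using k a_pos by (intro divide_right_mono) auto
      ultimately have "5 / 8 / a \<le> R" by (simp add: diff_divide_distrib)
      moreover have "5 / 8 / a \<le> (1 - k / 2) / a" using k a_pos by (intro divide_right_mono) auto
      ultimately have ea: "5 / 8 / a < e" using R_low by simp
      then have "5 / 8 / a * x < 1" using mult_right_mono[of "5 / 8 / a" e x] ex x_bounds by linarith
      then have x8: "x < 8 / 5 * a" using a_pos by (simp add: field_simps)
      have "5 / 4 \<le> 5 / 8 / a" using am a_pos by (simp add: field_simps)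
      then have "x * (1 - x) * (5 / 4)\<^sup>2 \<le> z" using z_low ea by simp
      moreover have "1 / 2 * (1 / 5) \<le> x * (1 - x)"
        using x8 am x_bounds m by (intro mult_mono) auto
      ultimately have "5 / 32 \<le> z" by (simp add: power2_eq_square)
      then have "5 / 37 \<le> z / (1 + z)" by (simp add: field_simps)
      then have ln: "5 / 37 \<le> ln (1 + z)" using ln_ge_frac[OF z0] by linarith
      have "\<mu> < k / (2 * a) * x" using small x_bounds by (simp add: field_simps)
      also have "\<dots> \<le> (1 / 2) / (2 * a) * (8 / 5 * a)"
        using k k_nonneg a_pos x8 x_bounds by (intro mult_mono divide_right_mono) auto
      also have "\<dots> = 2 / 5" using a_pos by simp
      finally have \<mu>2: "\<mu> \<le> 2 / 5" by simp
      have "Q \<le> 1 / 2 * (2 / 5)\<^sup>2 * 1"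
        unfolding Q_eq using k k_nonneg \<mu>2 \<mu>_bounds am m_pos a_pos
        by (intro mult_mono power_mono) (auto simp: field_simps)
      then have "Q \<le> 2 / 25" by (simp add: power2_eq_square)
      moreover have "D * \<mu> * \<omega> * (k / (2 * a) - \<mu> / x) \<le> D * \<mu> * \<omega> * (k / (2 * a))"
        using D_nonneg \<mu>_bounds \<omega> x_bounds by (intro mult_left_mono) auto
      moreover have "D * \<mu> * \<omega> * (k / (2 * a)) = k * k * (\<mu> * \<omega>) / 2"
        using a_pos by (simp add: D_eq)
      moreover have "k * k * (\<mu> * \<omega>) \<le> 1 / 2 * (1 / 2) * (2 / 5 * (1 / 2))"
        using k k_nonneg \<mu>2 \<mu>_bounds \<omega> by (intro mult_mono) auto
      ultimately have "Q + D * \<mu> * \<omega> * (k / (2 * a) - \<mu> / x) \<le> 21 / 200"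
        by linarith
      then show ?thesis using l1 ln by linarith
    qed
  qed
qed

text \<open>The three regimes cover all cases: \<open>k \<ge> 1 / 2\<close> is split at
  \<open>m = 4 / 9\<close>, smaller \<open>k\<close> at \<open>m = 1 / 2\<close>.\<close>

lemma backward_chord: "gain_down f x + ((1 - \<sigma>) * (D * \<mu> / x) + \<sigma> * (k * V)) \<le> B"
proof (cases "1 / 2 \<le> k")
  case True
  then show ?thesis using backward_large_k backward_small_m by linarith
next
  case False
  then show ?thesis using backward_small_k backward_small_m by linarith
qed

text \<open>The line through \<open>s = 0\<close> and the kink has the value
  \<open>D * \<mu> * m / (M * x)\<close> at \<open>s = 1\<close>. It is nonincreasing, so its
  intercept bounds it, and \<open>l1\<close> at \<open>p = \<mu>\<close> contains
  \<open>\<mu> * (D / m)\<close>.\<close>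

lemma backward_kink: "gain_down f x + ((1 - \<sigma>) * (D * \<mu> / x) + \<sigma> * (D * \<mu> * m / (M * x))) \<le> B"
proof -
  have "D * \<mu> * m / (M * x) \<le> D * \<mu> / x"
    using D_nonneg \<mu>_bounds m_pos m_le_M x_bounds
    by (intro divide_le_divide_cross) (auto simp: mult_ac intro!: mult_left_mono mult_right_mono)
  then have "(1 - \<sigma>) * (D * \<mu> / x) + \<sigma> * (D * \<mu> * m / (M * x)) \<le> (1 - \<sigma>) * (D * \<mu> / x) + \<sigma> * (D * \<mu> / x)"
    using \<sigma> by (intro add_left_mono mult_left_mono)
  also have "\<dots> = D * \<mu> / x" by (subst distrib_right[symmetric]) simp
  also have "\<dots> \<le> D * \<mu> / m"
    using D_nonneg \<mu>_bounds m_pos x_bounds by (intro divide_left_mono) auto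
  also have "\<dots> = \<mu> * (D / m)" by simp
  finally have 1: "(1 - \<sigma>) * (D * \<mu> / x) + \<sigma> * (D * \<mu> * m / (M * x)) \<le> \<mu> * (D / m)" .
  have "0 \<le> (1 - \<mu>) * \<mu> * (D / (1 - x))" using \<mu>_bounds D_nonneg x_bounds by auto
  then have "gain_up f x + \<mu> * (D / m) \<le> B" using bound1_x by linarith
  moreover have "gain_down f x \<le> gain_up f x" using f_nonneg x_bounds by (intro gain_down_le_up) auto
  ultimately show ?thesis using 1 by linarith
qed

end

section \<open>Affine majorants for the removal of a record\<close>

context suppression_bound
begin

text \<open>For \<open>n = 1\<close> the only record of \<open>D\<close> has normalised score
  \<open>0\<close> in \<open>D\<close> and \<open>s / 2\<close> in \<open>D'\<close>. Deletion then
  imposes no positive lower bound, and a line through the origin suffices for retention;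
  \<open>bound2_mid\<close> dominates it.\<close>

lemma backward_majorant_singleton:
  assumes \<sigma>: "0 \<le> \<sigma>" "\<sigma> \<le> 1"
  obtains \<beta> where "0 \<le> \<beta>"
    "\<And>s. 0 \<le> s \<Longrightarrow> s \<le> 1 \<Longrightarrow> - ln (1 - (M - m) / (1 - m) * s / 2) \<le> \<beta> * s"
    "gain_down f (m + (M - m) * (\<sigma> / 2)) + \<beta> * \<sigma> \<le> B"
proof -
  define a D k where "a = 1 - m" and "D = M - m" and "k = D / a"
  define \<beta> where "\<beta> = (k / 2) / (1 - k / 2)"
  have a: "0 < a" and D: "0 \<le> D" using m_le_M M_less_1 by (auto simp: a_def D_def)
  have ak: "D = k * a" using a by (simp add: k_def)
  have "D < a" using M_less_1 by (simp add: a_def D_def)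
  then have k: "0 \<le> k" "k < 1" using a D by (auto simp: k_def)
  have M_a: "1 - M = a * (1 - k)" using ak by (simp add: a_def D_def algebra_simps)
  have h: "0 < 1 - k / 2" using k by simp
  show thesis
  proof (rule that[of \<beta>])
    show "0 \<le> \<beta>" using k h by (simp add: \<beta>_def)
    fix s :: real assume s: "0 \<le> s" "s \<le> 1"
    define v where "v = k * s / 2"
    have "k * s \<le> k" using s k by (simp add: mult_left_le)
    then have v: "0 \<le> v" "v \<le> k / 2" using s k by (auto simp: v_def)
    then have v1: "0 < 1 - v" using h by linarith
    have "- ln (1 - v) = ln (1 / (1 - v))" using v1 by (simp add: ln_div)
    also have "\<dots> \<le> 1 / (1 - v) - 1" using v1 by (intro ln_le_minus_one) simp
    also have "\<dots> = v / (1 - v)" using v1 by (simp add: field_simps)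
    also have "\<dots> \<le> v / (1 - k / 2)" using v h v1 by (intro divide_left_mono mult_pos_pos) auto
    finally show "- ln (1 - (M - m) / (1 - m) * s / 2) \<le> \<beta> * s"
      by (simp add: \<beta>_def v_def k_def D_def a_def)
  next
    let ?x = "m + D * (\<sigma> / 2)"
    have x: "m \<le> ?x" "?x \<le> m + D / 2"
      using D \<sigma> by (auto simp: mult_left_le)
    have mid: "m + D / 2 < 1" using D M_less_1 by (simp add: D_def field_simps)
    have "gain_down f ?x \<le> gain_up f ?x"
      using x mid m_pos f_nonneg by (intro gain_down_le_up) auto
    also have "gain_up f ?x - gain_up f (m + D / 2) \<le> (m + D / 2 - ?x) / (1 - (m + D / 2))"
      using x mid f_nonneg by (intro gain_up_diff_le) auto
    also have "m + D / 2 - ?x = a * (k / 2 * (1 - \<sigma>))" by (simp add: ak field_simps)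
    also have "1 - (m + D / 2) = a * (1 - k / 2)" using ak by (simp add: a_def algebra_simps)
    finally have "gain_down f ?x - gain_up f (m + D / 2) \<le> \<beta> * (1 - \<sigma>)"
      using a by (simp add: \<beta>_def)
    moreover have "\<beta> \<le> D / (2 * (1 - M))"
    proof -
      have "\<beta> \<le> (k / 2) / (1 - k)"
        unfolding \<beta>_def using k h by (intro divide_left_mono mult_pos_pos) auto
      also have "\<dots> = D / (2 * (1 - M))" using a k by (simp add: M_a ak)
      finally show ?thesis .
    qed
    ultimately show "gain_down f (m + (M - m) * (\<sigma> / 2)) + \<beta> * \<sigma> \<le> B"
      using bound2_mid by (simp add: D_def[symmetric] algebra_simps)
  qed
qed

text \<open>The first condition is for retention, the second for deletion; \<open>u\<close> is the
  normalised score in \<open>D'\<close>, whence the factor \<open>n / (n + 1)\<close> at \<sigma>.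
  The intercept is the deletion bound at \<open>s = 0\<close>; the value at \<open>s = 1\<close> is
  the least that serves both \<open>k * V\<close> and the kink.\<close>

lemma backward_majorant:
  fixes n :: nat
  assumes n: "1 \<le> n" and \<sigma>: "0 \<le> \<sigma>" "\<sigma> \<le> 1"
  obtains \<alpha> \<beta> where
    "\<And>s. 0 \<le> s \<Longrightarrow> s \<le> 1 \<Longrightarrow> - real n * ln (1 - (M - m) / (1 - m) * s / (real n + 1)) \<le> \<alpha> + \<beta> * s"
    "\<And>s u. 0 \<le> s \<Longrightarrow> s \<le> 1 \<Longrightarrow> 0 \<le> u \<Longrightarrow> u \<le> 1 \<Longrightarrow> u \<le> s + real n / (real n + 1) * \<sigma> \<Longrightarrow>
       (n = 1 \<Longrightarrow> u \<le> s) \<Longrightarrow> (M - m) * (u - s) / (m + (M - m) * u) \<le> \<alpha> + \<beta> * s"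
    "gain_down f (m + (M - m) * (real n / (real n + 1) * \<sigma>)) + (\<alpha> + \<beta> * \<sigma>) \<le> B"
proof (cases "n = 1")
  case True
  obtain \<beta> where \<beta>: "0 \<le> \<beta>"
    "\<And>s. 0 \<le> s \<Longrightarrow> s \<le> 1 \<Longrightarrow> - ln (1 - (M - m) / (1 - m) * s / 2) \<le> \<beta> * s"
    "gain_down f (m + (M - m) * (\<sigma> / 2)) + \<beta> * \<sigma> \<le> B"
    using backward_majorant_singleton[OF \<sigma>] by metis
  show thesis
  proof (rule that[of 0 \<beta>])
    fix s u :: real assume s: "0 \<le> s" "s \<le> 1"
    show "- real n * ln (1 - (M - m) / (1 - m) * s / (real n + 1)) \<le> 0 + \<beta> * s"
      using \<beta>(2)[OF s] True by simp
    assume u: "0 \<le> u" "n = 1 \<Longrightarrow> u \<le> s"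
    have "(M - m) * (u - s) / (m + (M - m) * u) \<le> 0"
      using u True m_le_M m_pos by (intro divide_nonpos_nonneg mult_nonneg_nonpos) auto
    moreover have "0 \<le> \<beta> * s" using \<beta> s by simp
    ultimately show "(M - m) * (u - s) / (m + (M - m) * u) \<le> 0 + \<beta> * s" by linarith
  qed (use \<beta>(3) True in simp)
next
  case False
  define \<kappa> where "\<kappa> = real n / (real n + 1)"
  have n2: "2 \<le> real n" using n False by simp
  interpret backward_step m M f B \<kappa> \<sigma>
    using n2 \<sigma> by unfold_locales (auto simp: \<kappa>_def field_simps)
  define v where "v = max (k * V) (D * \<mu> * m / (M * x))"
  define \<alpha> where "\<alpha> = D * \<mu> / x"
  have Mpos: "0 < M" using m_pos m_le_M by simp
  have \<alpha>0: "0 \<le> \<alpha>" using D_nonneg \<mu>_bounds x_bounds by (simp add: \<alpha>_def)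
  have v0: "0 \<le> v" using k_nonneg V_nonneg by (auto simp: v_def le_max_iff_disj)
  show thesis
  proof (rule that[of \<alpha> "v - \<alpha>"], unfold D_def[symmetric] a_def[symmetric] k_def[symmetric] \<kappa>_def[symmetric] \<mu>_def[symmetric] x_def[symmetric])
    fix s :: real assume s: "0 \<le> s" "s \<le> 1"
    define w where "w = k * s / (real n + 1)"
    have w_le: "w \<le> k / (real n + 1)" "0 \<le> w"
      using s k_nonneg by (auto simp: w_def divide_right_mono mult_left_le)
    have "k / (real n + 1) < 1" using k_less_1 n2 by (simp add: field_simps)
    then have w1: "w < 1" using w_le by linarith
    \<comment> \<open>Equivalent to \<open>w / (1 - w) \<le> k / n\<close>, which makes the
      second-order term of \<open>minus_ln_le\<close> produce the summand \<open>k / 2\<close> in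
      the numerator of \<open>V\<close>.\<close>
    have "w * (real n + k) \<le> k / (real n + 1) * (real n + 1)"
      using w_le k_nonneg k_less_1 n2 by (intro mult_mono) auto
    then have "w * (real n + k) \<le> k" using n2 by simp
    then have "w / (2 * (1 - w)) \<le> k / (2 * real n)"
      using w1 n2 by (intro divide_le_divide_cross) (auto simp: algebra_simps)
    then have "w * (1 + w / (2 * (1 - w))) \<le> w * (1 + k / (2 * real n))"
      using w_le by (intro mult_left_mono) auto
    then have "- ln (1 - w) \<le> w * (1 + k / (2 * real n))" using minus_ln_le[OF w_le(2) w1] by linarith
    then have "real n * - ln (1 - w) \<le> real n * (w * (1 + k / (2 * real n)))"
      by (intro mult_left_mono) auto
    also have "\<dots> = s * (k * V)"
    proof -
      have V: "V = (real n + k / 2) / (real n + 1)"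
      proof -
        have "1 - \<kappa> = 1 / (real n + 1)" unfolding \<kappa>_def by (simp add: field_simps)
        then have "V = real n / (real n + 1) + 1 / (real n + 1) * (k / 2)"
          unfolding V_def by (simp only: \<kappa>_def[symmetric])
        then show ?thesis by (simp add: add_divide_distrib)
      qed
      have "real n * (1 + k / (2 * real n)) = real n + k / 2" using n2 by (simp add: field_simps)
      then have "real n * (w * (1 + k / (2 * real n))) = w * (real n + k / 2)"
        by (metis mult.left_commute)
      then show ?thesis unfolding V w_def by simp
    qed
    also have "\<dots> \<le> s * v" using s by (intro mult_left_mono) (auto simp: v_def)
    also have "\<dots> \<le> s * v + (1 - s) * \<alpha>" using s \<alpha>0 by simp
    finally show "- real n * ln (1 - k * s / (real n + 1)) \<le> \<alpha> + (v - \<alpha>) * s"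
      by (simp add: w_def algebra_simps)
  next
    fix s u :: real assume su: "0 \<le> s" "s \<le> 1" "0 \<le> u" "u \<le> 1" "u \<le> s + \<mu>"
    have "D * \<mu> * m / (M * x) * (1 - \<mu>) = D * \<mu> / M - \<alpha> * \<mu>"
    proof -
      have "D * \<mu> / M - \<alpha> * \<mu> = D * \<mu> * (x - \<mu> * M) / (M * x)"
        using Mpos x_bounds by (simp add: \<alpha>_def field_simps)
      also have "x - \<mu> * M = m * (1 - \<mu>)" by (simp add: x_def D_def algebra_simps)
      finally show ?thesis by simp
    qed
    moreover have "D * \<mu> * m / (M * x) * (1 - \<mu>) \<le> v * (1 - \<mu>)"
      using \<mu>_bounds by (intro mult_right_mono) (auto simp: v_def)
    ultimately have kink: "D * \<mu> / M \<le> \<alpha> + (v - \<alpha>) * (1 - \<mu>)" by (simp add: algebra_simps)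
    show "D * (u - s) / (m + D * u) \<le> \<alpha> + (v - \<alpha>) * s"
      by (rule affine_majorant_three_points[OF m_pos _ D_nonneg \<mu>_bounds(1,4) su])
        (use kink Mpos v0 in \<open>auto simp: M_eq \<alpha>_def x_def\<close>)
  next
    have "\<alpha> + (v - \<alpha>) * \<sigma> = (1 - \<sigma>) * (D * \<mu> / x) + \<sigma> * v"
      by (simp add: \<alpha>_def[symmetric] algebra_simps)
    then show "gain_down f x + (\<alpha> + (v - \<alpha>) * \<sigma>) \<le> B"
      using backward_chord backward_kink by (simp add: v_def max_def)
  qed
qed

end

section \<open>Independent deletion\<close>

lemma finite_submultisets: "finite {C. C \<subseteq># D}"
proof (induction D)
  case (add z D)
  have "{C. C \<subseteq># add_mset z D} \<subseteq> {C. C \<subseteq># D} \<union> add_mset z ` {C. C \<subseteq># D}"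
  proof
    fix C assume "C \<in> {C. C \<subseteq># add_mset z D}"
    then have C: "C \<subseteq># add_mset z D" by simp
    show "C \<in> {C. C \<subseteq># D} \<union> add_mset z ` {C. C \<subseteq># D}"
    proof (cases "z \<in># C")
      case True
      then have "C = add_mset z (C - {#z#})" by simp
      moreover from this C have "C - {#z#} \<subseteq># D" by (metis mset_subset_eq_add_mset_cancel)
      ultimately show ?thesis by blast
    next
      case False
      have "count C x \<le> count D x" for x
        using mset_subset_eq_count[OF C, of x] False by (cases "x = z") (auto simp: not_in_iff)
      then show ?thesis by (simp add: subseteq_mset_def)
    qed
  qed
  then show ?case using add by (meson finite_UnI finite_imageI finite_subset)
qed simp

text \<open>Factors outside \<open>D\<close> equal \<open>1\<close>; \<open>D\<close> and
  \<open>add_mset z D\<close> can thus be compared over one index set.\<close>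

lemma indep_deletion_prob_superset:
  assumes "C \<subseteq># D" "finite A" "set_mset D \<subseteq> A"
  shows "indep_deletion_prob q D C = (\<Prod>x\<in>A. real (count D x choose count C x) *
    (1 - q x) ^ count C x * q x ^ (count D x - count C x))"
  unfolding indep_deletion_prob_def
proof (rule prod.mono_neutral_left[OF assms(2,3)], intro ballI)
  fix x assume "x \<in> A - set_mset D"
  then have "count D x = 0" by (simp add: not_in_iff)
  moreover have "count C x \<le> count D x" using assms(1) by (rule mset_subset_eq_count)
  ultimately show "real (count D x choose count C x) * (1 - q x) ^ count C x * q x ^ (count D x - count C x) = 1"
    by simp
qed

text \<open>Only the factor of \<open>z\<close> changes, and Pascal's rule splits its binomial
  coefficient according to whether the added copy is kept or deleted.\<close>

lemma indep_deletion_prob_add_mset: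
  assumes C: "C \<subseteq># add_mset z D"
  shows "indep_deletion_prob q (add_mset z D) C =
    (if z \<in># C then (1 - q z) * indep_deletion_prob q D (C - {#z#}) else 0)
    + (if C \<subseteq># D then q z * indep_deletion_prob q D C else 0)"
proof -
  define A where "A = set_mset D - {z}"
  define t where "t D C x = real (count D x choose count C x) * (1 - q x) ^ count C x * q x ^ (count D x - count C x)"
    for D C :: "'a multiset" and x
  have expand: "indep_deletion_prob q E F = t E F z * (\<Prod>x\<in>A. t E F x)"
    if "F \<subseteq># E" "set_mset E \<subseteq> insert z A" for E F
  proof -
    have "finite A" "z \<notin> A" by (auto simp: A_def)
    then show ?thesis
      using indep_deletion_prob_superset[OF that(1) _ that(2), of q] by (simp add: t_def)
  qed
  have same: "(\<Prod>x\<in>A. t E F x) = (\<Prod>x\<in>A. t D C x)"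
    if "\<And>x. x \<noteq> z \<Longrightarrow> count E x = count D x" "\<And>x. x \<noteq> z \<Longrightarrow> count F x = count C x" for E F
    using that by (intro prod.cong) (auto simp: A_def t_def)
  define n where "n = count D z"
  define j where "j = count C z"
  define P where "P = (\<Prod>x\<in>A. t D C x)"
  have j: "j \<le> Suc n" using mset_subset_eq_count[OF C, of z] by (simp add: j_def n_def)
  have sub_iff: "C \<subseteq># D \<longleftrightarrow> j \<le> n"
  proof
    assume "j \<le> n"
    then show "C \<subseteq># D"
      using mset_subset_eq_count[OF C] by (intro mset_subset_eqI) (metis count_add_mset j_def n_def)
  qed (auto simp: j_def n_def mset_subset_eq_count)
  have 1: "indep_deletion_prob q (add_mset z D) C
      = real (Suc n choose j) * (1 - q z) ^ j * q z ^ (Suc n - j) * P"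
  proof -
    have "(\<Prod>x\<in>A. t (add_mset z D) C x) = P" unfolding P_def by (rule same) auto
    then show ?thesis using expand[OF C] by (auto simp: t_def n_def j_def A_def)
  qed
  have 2: "indep_deletion_prob q D C = real (n choose j) * (1 - q z) ^ j * q z ^ (n - j) * P" if "j \<le> n"
    using expand[of C D] that sub_iff by (auto simp: t_def n_def j_def A_def P_def)
  have 3: "indep_deletion_prob q D (C - {#z#})
      = real (n choose (j - 1)) * (1 - q z) ^ (j - 1) * q z ^ (n - (j - 1)) * P" if "0 < j"
  proof -
    have "C - {#z#} \<subseteq># D" using C that by (simp add: j_def subset_eq_diff_conv)
    moreover have "(\<Prod>x\<in>A. t D (C - {#z#}) x) = P" unfolding P_def by (rule same) auto
    ultimately show ?thesis using expand[of "C - {#z#}" D] by (auto simp: t_def n_def j_def A_def)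
  qed
  have zC: "z \<in># C \<longleftrightarrow> 0 < j" by (simp add: j_def)
  show ?thesis
  proof (cases j)
    case 0
    then show ?thesis using 1 2 zC sub_iff by simp
  next
    case (Suc i)
    show ?thesis
    proof (cases "j \<le> n")
      case True
      then have "n - i = Suc (n - j)" using Suc by simp
      then show ?thesis using zC sub_iff True Suc by (simp add: 1 2 3 algebra_simps)
    next
      \<comment> \<open>All \<open>n + 1\<close> copies of \<open>z\<close> are kept, so the
        deletion term is absent.\<close>
      case False
      then have "n = i" using j Suc by simp
      then show ?thesis using 1 3 zC sub_iff False Suc by simp
    qed
  qed
qed

text \<open>Conditioning on the fate of the added copy. General \<open>F\<close> covers both the
  event probabilities and, with \<open>F = 1\<close>, the normalisation.\<close>

lemma sum_indep_deletion_prob_add_mset: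
  "(\<Sum>C | C \<subseteq># add_mset z D. indep_deletion_prob q (add_mset z D) C * F C)
    = (\<Sum>C | C \<subseteq># D. indep_deletion_prob q D C * ((1 - q z) * F (add_mset z C) + q z * F C))"
proof -
  let ?w = "indep_deletion_prob q D"
  let ?S = "{C. C \<subseteq># add_mset z D}"
  have fin: "finite ?S" "finite {C. C \<subseteq># D}" by (rule finite_submultisets)+
  have "(\<Sum>C\<in>?S. indep_deletion_prob q (add_mset z D) C * F C)
      = (\<Sum>C\<in>?S. (if z \<in># C then (1 - q z) * ?w (C - {#z#}) * F C else 0)
          + (if C \<subseteq># D then q z * ?w C * F C else 0))"
    by (intro sum.cong) (auto simp: indep_deletion_prob_add_mset algebra_simps)
  also have "\<dots> = (\<Sum>C\<in>?S. if z \<in># C then (1 - q z) * ?w (C - {#z#}) * F C else 0)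
      + (\<Sum>C\<in>?S. if C \<subseteq># D then q z * ?w C * F C else 0)"
    by (rule sum.distrib)
  also have "(\<Sum>C\<in>?S. if z \<in># C then (1 - q z) * ?w (C - {#z#}) * F C else 0)
      = (\<Sum>C | C \<subseteq># add_mset z D \<and> z \<in># C. (1 - q z) * ?w (C - {#z#}) * F C)"
    using fin by (simp add: sum.inter_filter[symmetric])
  also have "\<dots> = (\<Sum>C | C \<subseteq># D. (1 - q z) * ?w C * F (add_mset z C))"
    by (rule sum.reindex_bij_witness[of _ "add_mset z" "\<lambda>C. C - {#z#}"])
      (auto simp: subset_eq_diff_conv)
  also have "(\<Sum>C\<in>?S. if C \<subseteq># D then q z * ?w C * F C else 0)
      = (\<Sum>C | C \<subseteq># add_mset z D \<and> C \<subseteq># D. q z * ?w C * F C)"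
    using fin by (simp add: sum.inter_filter[symmetric])
  also have "{C. C \<subseteq># add_mset z D \<and> C \<subseteq># D} = {C. C \<subseteq># D}"
  proof -
    have "D \<subseteq># add_mset z D" by (simp add: subseteq_mset_def)
    then show ?thesis by (auto intro: subset_mset.order_trans)
  qed
  also have "(\<Sum>C | C \<subseteq># D. (1 - q z) * ?w C * F (add_mset z C)) + (\<Sum>C | C \<subseteq># D. q z * ?w C * F C)
      = (\<Sum>C | C \<subseteq># D. ?w C * ((1 - q z) * F (add_mset z C) + q z * F C))"
    by (subst sum.distrib[symmetric], rule sum.cong) (auto simp: algebra_simps)
  finally show ?thesis .
qed

lemma indep_deletion_prob_nonneg:
  assumes "\<And>x. x \<in># D \<Longrightarrow> 0 \<le> q x \<and> q x \<le> 1"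
  shows "0 \<le> indep_deletion_prob q D C"
  unfolding indep_deletion_prob_def using assms by (intro prod_nonneg) auto

text \<open>Each occurrence of \<open>x\<close> contributes one factor \<open>exp (g x)\<close>,
  kept or deleted, so the total does not depend on \<open>C\<close>.\<close>

lemma indep_deletion_prob_ratio:
  assumes C: "C \<subseteq># D"
    and q: "\<And>x. x \<in># D \<Longrightarrow> 0 \<le> q x \<and> q x \<le> 1"
    and del: "\<And>x. x \<in># D \<Longrightarrow> q x \<le> exp (g x) * q' x"
    and keep: "\<And>x. x \<in># D \<Longrightarrow> 1 - q x \<le> exp (g x) * (1 - q' x)"
  shows "indep_deletion_prob q D C \<le> exp (\<Sum>x\<in>#D. g x) * indep_deletion_prob q' D C"
proof -
  let ?t = "\<lambda>q x. real (count D x choose count C x) * (1 - q x) ^ count C x * q x ^ (count D x - count C x)"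
  have "exp (\<Sum>x\<in>#D. g x) = (\<Prod>x\<in>#D. exp (g x))" by (induction D) (auto simp: exp_add)
  also have "\<dots> = (\<Prod>x\<in>set_mset D. exp (g x) ^ count D x)"
    by (rule image_prod_mset_multiplicity)
  finally have e: "exp (\<Sum>x\<in>#D. g x) = (\<Prod>x\<in>set_mset D. exp (g x) ^ count D x)" .
  have "indep_deletion_prob q D C \<le> (\<Prod>x\<in>set_mset D. exp (g x) ^ count D x * ?t q' x)"
    unfolding indep_deletion_prob_def
  proof (rule prod_mono, intro conjI)
    fix x assume x: "x \<in># D"
    show "0 \<le> ?t q x" using q[OF x] by simp
    have "count C x \<le> count D x" using C by (rule mset_subset_eq_count)
    then have pow: "exp (g x) ^ count D x = exp (g x) ^ count C x * exp (g x) ^ (count D x - count C x)"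
      by (simp add: power_add[symmetric])
    have "(1 - q x) ^ count C x * q x ^ (count D x - count C x)
        \<le> (exp (g x) * (1 - q' x)) ^ count C x * (exp (g x) * q' x) ^ (count D x - count C x)"
      using q[OF x] del[OF x] keep[OF x]
      by (intro mult_mono power_mono) (auto intro!: zero_le_power intro: order_trans)
    also have "\<dots> = exp (g x) ^ count D x * ((1 - q' x) ^ count C x * q' x ^ (count D x - count C x))"
      by (simp add: pow power_mult_distrib)
    finally have "real (count D x choose count C x) * ((1 - q x) ^ count C x * q x ^ (count D x - count C x))
        \<le> real (count D x choose count C x) * (exp (g x) ^ count D x * ((1 - q' x) ^ count C x * q' x ^ (count D x - count C x)))"
      by (rule mult_left_mono) simp
    then show "?t q x \<le> exp (g x) ^ count D x * ?t q' x" by (simp add: mult_ac)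
  qed
  also have "\<dots> = exp (\<Sum>x\<in>#D. g x) * indep_deletion_prob q' D C"
    by (simp add: e prod.distrib indep_deletion_prob_def)
  finally show ?thesis .
qed

section \<open>Scores of neighbouring databases\<close>

context suppression_bound
begin

text \<open>The normalised score of a record moves from \<open>u\<close> to
  \<open>u + (s - u) / (n + 1)\<close>. Both bounds are linear in this shift and pass to the
  exponential by \<open>1 + t \<le> exp t\<close>.\<close>

lemma forward_ratio:
  fixes n :: nat and s u G :: real
  assumes s: "0 \<le> s" and u: "0 \<le> u" "u \<le> 1"
    and G1: "(M - m) * s / m \<le> G" and G2: "(M - m) * (u - s) / (1 - m - (M - m) * u) \<le> G"
  shows "m + (M - m) * ((real n * u + s) / (real n + 1)) \<le> exp (G / (real n + 1)) * (m + (M - m) * u)"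
    and "1 - (m + (M - m) * ((real n * u + s) / (real n + 1))) \<le> exp (G / (real n + 1)) * (1 - (m + (M - m) * u))"
proof -
  let ?D = "M - m" and ?N = "real n + 1"
  define q where "q = m + ?D * u"
  have q: "m \<le> q" "q < 1" using m_le_score[OF u(1)] score_le_M[OF u] M_less_1 by (auto simp: q_def)
  have "(real n * u + s) / ?N = u + (s - u) / ?N" by (simp add: field_simps)
  then have q': "m + ?D * ((real n * u + s) / ?N) = q + ?D * (s - u) / ?N"
    by (simp add: q_def distrib_left)
  have "0 \<le> ?D * s / m" using m_le_M m_pos s by simp
  then have "0 \<le> G" using G1 by linarith
  have "?D * s \<le> G * m" using G1 m_pos by (simp add: pos_divide_le_eq)
  also have "\<dots> \<le> G * q" using q \<open>0 \<le> G\<close> by (intro mult_left_mono)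
  finally have "?D * (s - u) \<le> G * q"
    using m_le_M u by (simp add: right_diff_distrib) (smt (verit) mult_nonneg_nonneg)
  then have "?D * (s - u) / ?N \<le> G / ?N * q" by (simp add: divide_right_mono)
  then have "q + ?D * (s - u) / ?N \<le> (1 + G / ?N) * q" by (simp add: distrib_right)
  also have "\<dots> \<le> exp (G / ?N) * q" using q m_pos by (intro mult_right_mono exp_ge_add_one_self) auto
  finally show "m + ?D * ((real n * u + s) / ?N) \<le> exp (G / ?N) * (m + ?D * u)"
    unfolding q' q_def .
  have e: "1 - m - ?D * u = 1 - q" by (simp add: q_def)
  have "?D * (u - s) \<le> G * (1 - q)" using G2[unfolded e] q by (simp add: pos_divide_le_eq)
  then have "?D * (u - s) / ?N \<le> G / ?N * (1 - q)" by (simp add: divide_right_mono)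
  moreover have "?D * (u - s) / ?N = - (?D * (s - u) / ?N)" by (simp add: minus_divide_left right_diff_distrib)
  ultimately have "1 - (q + ?D * (s - u) / ?N) \<le> (1 + G / ?N) * (1 - q)" by (simp add: distrib_right)
  also have "\<dots> \<le> exp (G / ?N) * (1 - q)" using q by (intro mult_right_mono exp_ge_add_one_self) auto
  finally show "1 - (m + ?D * ((real n * u + s) / ?N)) \<le> exp (G / ?N) * (1 - (m + ?D * u))"
    unfolding q' q_def .
qed

text \<open>For deletion the old score is written as \<open>u' + (u' - s) / n\<close>, so that the
  \<open>D'\<close> score is in the denominator. For retention the logarithm is kept in the
  hypothesis, since its linearisation would lose too much.\<close>

lemma backward_ratio:
  fixes n :: nat and s u G :: real
  assumes n: "1 \<le> n" and s: "0 \<le> s" "s \<le> 1" and u: "0 \<le> u" "u \<le> 1"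
    and u': "u' = (real n * u + s) / (real n + 1)"
    and G1: "- real n * ln (1 - (M - m) / (1 - m) * s / (real n + 1)) \<le> G"
    and G2: "(M - m) * (u' - s) / (m + (M - m) * u') \<le> G"
  shows "m + (M - m) * u \<le> exp (G / real n) * (m + (M - m) * u')"
    and "1 - (m + (M - m) * u) \<le> exp (G / real n) * (1 - (m + (M - m) * u'))"
proof -
  let ?D = "M - m" and ?N = "real n + 1"
  define k where "k = ?D / (1 - m)"
  have n0: "0 < real n" using n by simp
  have u'01: "0 \<le> u'" "u' \<le> 1"
  proof -
    have "real n * u \<le> real n" using u by (simp add: mult_left_le)
    then show "0 \<le> u'" "u' \<le> 1" using s u by (auto simp: u' divide_le_eq_1)
  qed
  define q' where "q' = m + ?D * u'"
  have q': "m \<le> q'" "q' < 1" using m_le_score[OF u'01(1)] score_le_M[OF u'01] M_less_1 by (auto simp: q'_def)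
  have "(real n + 1) * u' = real n * u + s" by (simp add: u')
  then have "u = u' + (u' - s) / real n" using n0 by (simp add: field_simps)
  then have "?D * u = ?D * u' + ?D * (u' - s) / real n"
    by (metis distrib_left times_divide_eq_right)
  then have q: "m + ?D * u = q' + ?D * (u' - s) / real n" by (simp add: q'_def)
  have "?D * (u' - s) \<le> G * q'" using G2 q' m_pos by (simp add: q'_def[symmetric] pos_divide_le_eq)
  then have "?D * (u' - s) / real n \<le> G / real n * q'" by (simp add: divide_right_mono)
  then have "q' + ?D * (u' - s) / real n \<le> (1 + G / real n) * q'" by (simp add: distrib_right)
  also have "\<dots> \<le> exp (G / real n) * q'" using q' m_pos by (intro mult_right_mono exp_ge_add_one_self) auto
  finally show "m + ?D * u \<le> exp (G / real n) * (m + ?D * u')" unfolding q q'_def .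
  have k: "0 \<le> k" "k < 1" using m_le_M M_less_1 by (auto simp: k_def)
  have ks: "0 \<le> k * s" "k * s \<le> 1" using k s by (auto intro: mult_le_one)
  then have v: "0 < 1 - k * s / ?N" using n0 by (simp add: field_simps)
  have "- ln (1 - k * s / ?N) \<le> G / real n"
    using G1 n0 unfolding k_def by (simp add: pos_le_divide_eq mult.commute)
  then have "exp (- ln (1 - k * s / ?N)) \<le> exp (G / real n)" by simp
  then have ev: "1 / (1 - k * s / ?N) \<le> exp (G / real n)" using v by (simp add: exp_minus inverse_eq_divide)
  have "1 - (m + ?D * u) \<le> 1 / (1 - k * s / ?N) * (1 - q')"
  proof -
    \<comment> \<open>Equality holds at \<open>u = 0\<close>, so the retention factor
      \<open>1 / (1 - k * s / ?N)\<close> is attained there.\<close>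
    have "?D * (s - u) \<le> (1 - (m + ?D * u)) * (k * s)"
    proof -
      have "(1 - (m + ?D * u)) * (k * s) = (1 - m) * k * s - ?D * u * (k * s)" by (simp add: algebra_simps)
      moreover have "(1 - m) * k = ?D" using m_le_M M_less_1 by (simp add: k_def)
      moreover have "?D * u * (k * s) \<le> ?D * u" using ks m_le_M u by (simp add: mult_left_le)
      ultimately show ?thesis by (simp add: right_diff_distrib)
    qed
    then have "?D * (s - u) / ?N \<le> (1 - (m + ?D * u)) * (k * s) / ?N" by (simp add: divide_right_mono)
    moreover have "q' = (m + ?D * u) + ?D * (s - u) / ?N"
    proof -
      have "u' = u + (s - u) / ?N" by (simp add: u' field_simps)
      then show ?thesis by (simp add: q'_def distrib_left)
    qed
    ultimately have "(1 - (m + ?D * u)) * (1 - k * s / ?N) \<le> 1 - q'" by (simp add: right_diff_distrib)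
    then show ?thesis using v by (simp add: pos_le_divide_eq)
  qed
  also have "\<dots> \<le> exp (G / real n) * (1 - q')" using ev q' by (intro mult_right_mono) auto
  finally show "1 - (m + ?D * u) \<le> exp (G / real n) * (1 - (m + ?D * u'))" unfolding q'_def .
qed

end

section \<open>Mean distances and their change under an added record\<close>

definition mean_distance :: "('a \<Rightarrow> 'a \<Rightarrow> real) \<Rightarrow> 'a multiset \<Rightarrow> 'a \<Rightarrow> real" where
  "mean_distance d D x = (\<Sum>y\<in>#D. d x y) / real (size D)"

lemma sum_mset_affine:
  fixes h :: "'a \<Rightarrow> real"
  shows "(\<Sum>y\<in>#D. a + b * h y) = real (size D) * a + b * (\<Sum>y\<in>#D. h y)"
  by (induction D) (auto simp: algebra_simps)

lemma outlier_score_eq: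
  assumes "D \<noteq> {#}"
  shows "outlier_score d m M D x = m + (M - m) * mean_distance d D x"
  using assms unfolding outlier_score_def transformed_distance_def mean_distance_def sum_mset_affine
  by (simp add: field_simps)

lemma mean_distance_add_mset:
  "mean_distance d (add_mset z D) x = (real (size D) * mean_distance d D x + d x z) / (real (size D) + 1)"
  by (cases "D = {#}") (auto simp: mean_distance_def add.commute)

lemma mean_distance_le:
  assumes "D \<noteq> {#}" "\<And>y. y \<in># D \<Longrightarrow> d x y \<le> c + h y"
  shows "mean_distance d D x \<le> c + (\<Sum>y\<in>#D. h y) / real (size D)"
proof -
  have "(\<Sum>y\<in>#D. d x y) \<le> (\<Sum>y\<in>#D. c + 1 * h y)" using assms by (intro sum_mset_mono) auto
  also have "\<dots> = real (size D) * c + (\<Sum>y\<in>#D. h y)" by (subst sum_mset_affine) simp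
  finally have "(\<Sum>y\<in>#D. d x y) / real (size D) \<le> (real (size D) * c + (\<Sum>y\<in>#D. h y)) / real (size D)"
    by (rule divide_right_mono) simp
  then show ?thesis using assms(1) by (simp add: mean_distance_def add_divide_distrib)
qed

lemma mean_distance_bounds:
  assumes "\<And>x y. 0 \<le> d x y \<and> d x y \<le> 1"
  shows "0 \<le> mean_distance d D x" "mean_distance d D x \<le> 1"
proof -
  show "0 \<le> mean_distance d D x" unfolding mean_distance_def using assms
    by (intro divide_nonneg_nonneg) (induction D, auto)
  show "mean_distance d D x \<le> 1"
    using mean_distance_le[of D d x 1 "\<lambda>_. 0"] assms by (cases "D = {#}") (auto simp: mean_distance_def)
qed

locale distance_suppression = suppression_bound +
  fixes d :: "'a \<Rightarrow> 'a \<Rightarrow> real"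
  assumes d: "normalized_distance d"
begin

lemma d_bounds: "0 \<le> d x y \<and> d x y \<le> 1" and d_refl: "d x x = 0"
  and d_sym: "d x y = d y x" and d_triangle: "d x z \<le> d x y + d y z"
  using d unfolding normalized_distance_def by simp_all

lemma outlier_score_bounds:
  assumes "D \<noteq> {#}"
  shows "m \<le> outlier_score d m M D x" "outlier_score d m M D x \<le> M"
  unfolding outlier_score_eq[OF assms]
  using m_le_score score_le_M mean_distance_bounds[of d D x] d_bounds by auto

lemma mean_distance_triangle:
  assumes "D \<noteq> {#}"
  shows "mean_distance d D y \<le> d y z + mean_distance d D z"
  using mean_distance_le[OF assms, of d y "d y z" "d z"] d_triangle by (simp add: mean_distance_def)

lemma sum_affine_distance:
  assumes "D \<noteq> {#}"
  shows "(\<Sum>y\<in>#D. (\<alpha> + \<beta> * d y z) / c) = real (size D) / c * (\<alpha> + \<beta> * mean_distance d D z)"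
proof -
  have "(\<Sum>y\<in>#D. (\<alpha> + \<beta> * d y z) / c) = (\<Sum>y\<in>#D. \<alpha> / c + \<beta> / c * d z y)"
    by (simp add: add_divide_distrib d_sym[of _ z])
  also have "\<dots> = real (size D) * (\<alpha> / c) + \<beta> / c * (\<Sum>y\<in>#D. d z y)" by (rule sum_mset_affine)
  also have "(\<Sum>y\<in>#D. d z y) = real (size D) * mean_distance d D z"
    using assms by (simp add: mean_distance_def)
  finally show ?thesis by (simp add: distrib_left mult_ac)
qed

text \<open>The record \<open>z\<close> has distance zero to itself, while the size grows by
  one.\<close>

lemma outlier_score_new:
  "outlier_score d m M (add_mset z D) z
    = m + (M - m) * (real (size D) / (real (size D) + 1) * mean_distance d D z)"
  by (simp add: outlier_score_eq mean_distance_add_mset d_refl)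

text \<open>Both laws live on sub-multisets of \<open>D\<close>; only the scores differ.
  \<open>G\<close> sums the affine majorants over \<open>D\<close>, and the loss from the fate of
  \<open>z\<close> completes it to \<open>B\<close>. For empty \<open>D\<close> the claim is
  \<open>l1\<close> at \<open>p = 0\<close>.\<close>

lemma forward_weights:
  obtains G where
    "\<And>C. C \<subseteq># D \<Longrightarrow> indep_deletion_prob (outlier_score d m M (add_mset z D)) D C
        \<le> exp G * indep_deletion_prob (outlier_score d m M D) D C"
    "gain_up f (outlier_score d m M (add_mset z D) z) + G \<le> B"
proof (cases "D = {#}")
  case True
  show thesis
    by (rule that[of 0]) (use True bound1[of 0] in \<open>auto simp: indep_deletion_prob_def outlier_score_new\<close>)
next
  case False
  define n where "n = size D"
  define \<sigma> where "\<sigma> = mean_distance d D z"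
  have \<sigma>: "0 \<le> \<sigma>" "\<sigma> \<le> 1" using mean_distance_bounds[of d] d_bounds by (auto simp: \<sigma>_def)
  have \<kappa>: "0 \<le> real n / (real n + 1)" "real n / (real n + 1) \<le> 1" by auto
  obtain \<alpha> \<beta> where ab:
    "\<And>s. 0 \<le> s \<Longrightarrow> s \<le> 1 \<Longrightarrow> (M - m) * s / m \<le> \<alpha> + \<beta> * s"
    "\<And>s u. 0 \<le> s \<Longrightarrow> s \<le> 1 \<Longrightarrow> 0 \<le> u \<Longrightarrow> u \<le> 1 \<Longrightarrow> u \<le> s + \<sigma> \<Longrightarrow>
       (M - m) * (u - s) / (1 - m - (M - m) * u) \<le> \<alpha> + \<beta> * s"
    "gain_up f (m + (M - m) * (real n / (real n + 1) * \<sigma>)) + real n / (real n + 1) * (\<alpha> + \<beta> * \<sigma>) \<le> B"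
    using forward_majorant[OF \<kappa> \<sigma>] by metis
  define g where "g y = (\<alpha> + \<beta> * d y z) / (real n + 1)" for y
  have G: "(\<Sum>y\<in>#D. g y) = real n / (real n + 1) * (\<alpha> + \<beta> * \<sigma>)"
    unfolding g_def n_def \<sigma>_def by (rule sum_affine_distance[OF False])
  show thesis
  proof (rule that)
    show "gain_up f (outlier_score d m M (add_mset z D) z) + (\<Sum>y\<in>#D. g y) \<le> B"
      using ab(3) by (simp add: G outlier_score_new n_def \<sigma>_def)
    fix C assume C: "C \<subseteq># D"
    have ratio: "outlier_score d m M (add_mset z D) y \<le> exp (g y) * outlier_score d m M D y"
      "1 - outlier_score d m M (add_mset z D) y \<le> exp (g y) * (1 - outlier_score d m M D y)" for y
    proof -
      have y: "0 \<le> d y z" "d y z \<le> 1" using d_bounds by auto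
      have u: "0 \<le> mean_distance d D y" "mean_distance d D y \<le> 1"
        using mean_distance_bounds[of d] d_bounds by auto
      have t: "mean_distance d D y \<le> d y z + \<sigma>"
        unfolding \<sigma>_def by (rule mean_distance_triangle[OF False])
      note r = forward_ratio[OF y(1) u ab(1)[OF y] ab(2)[OF y u t], of n]
      show "outlier_score d m M (add_mset z D) y \<le> exp (g y) * outlier_score d m M D y"
        "1 - outlier_score d m M (add_mset z D) y \<le> exp (g y) * (1 - outlier_score d m M D y)"
        using r by (simp_all add: outlier_score_eq False mean_distance_add_mset g_def n_def)
    qed
    show "indep_deletion_prob (outlier_score d m M (add_mset z D)) D C
        \<le> exp (\<Sum>y\<in>#D. g y) * indep_deletion_prob (outlier_score d m M D) D C"
    proof (rule indep_deletion_prob_ratio[OF C _ ratio])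
      fix y
      show "0 \<le> outlier_score d m M (add_mset z D) y \<and> outlier_score d m M (add_mset z D) y \<le> 1"
        using outlier_score_bounds[of "add_mset z D" y] m_pos M_less_1 by simp
    qed
  qed
qed

text \<open>The counterpart of \<open>forward_weights\<close> with the laws exchanged. The majorants
  are divided by \<open>n\<close> instead of \<open>n + 1\<close>, so their sum is the majorant at
  the mean distance.\<close>

lemma backward_weights:
  obtains G where
    "\<And>C. C \<subseteq># D \<Longrightarrow> indep_deletion_prob (outlier_score d m M D) D C
        \<le> exp G * indep_deletion_prob (outlier_score d m M (add_mset z D)) D C"
    "gain_down f (outlier_score d m M (add_mset z D) z) + G \<le> B"
proof (cases "D = {#}")
  case True
  have "gain_down f m \<le> gain_up f m" using f_nonneg m_pos m_le_M M_less_1 by (intro gain_down_le_up) auto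
  then have "gain_down f m \<le> B" using bound1[of 0] by simp
  then show thesis
    by (intro that[of 0]) (use True in \<open>auto simp: indep_deletion_prob_def outlier_score_new\<close>)
next
  case False
  define n where "n = size D"
  have n: "1 \<le> n" using False by (simp add: n_def Suc_le_eq nonempty_has_size[symmetric])
  define \<sigma> where "\<sigma> = mean_distance d D z"
  have \<sigma>: "0 \<le> \<sigma>" "\<sigma> \<le> 1" using mean_distance_bounds[of d] d_bounds by (auto simp: \<sigma>_def)
  obtain \<alpha> \<beta> where ab:
    "\<And>s. 0 \<le> s \<Longrightarrow> s \<le> 1 \<Longrightarrow> - real n * ln (1 - (M - m) / (1 - m) * s / (real n + 1)) \<le> \<alpha> + \<beta> * s"
    "\<And>s u. 0 \<le> s \<Longrightarrow> s \<le> 1 \<Longrightarrow> 0 \<le> u \<Longrightarrow> u \<le> 1 \<Longrightarrow> u \<le> s + real n / (real n + 1) * \<sigma> \<Longrightarrow>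
       (n = 1 \<Longrightarrow> u \<le> s) \<Longrightarrow> (M - m) * (u - s) / (m + (M - m) * u) \<le> \<alpha> + \<beta> * s"
    "gain_down f (m + (M - m) * (real n / (real n + 1) * \<sigma>)) + (\<alpha> + \<beta> * \<sigma>) \<le> B"
    using backward_majorant[OF n \<sigma>] by metis
  define g where "g y = (\<alpha> + \<beta> * d y z) / real n" for y
  have G: "(\<Sum>y\<in>#D. g y) = \<alpha> + \<beta> * \<sigma>"
    unfolding g_def \<sigma>_def sum_affine_distance[OF False] using False by (simp add: n_def)
  show thesis
  proof (rule that)
    show "gain_down f (outlier_score d m M (add_mset z D) z) + (\<Sum>y\<in>#D. g y) \<le> B"
      using ab(3) by (simp add: G outlier_score_new n_def \<sigma>_def)
    fix C assume C: "C \<subseteq># D"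
    have ratio: "outlier_score d m M D y \<le> exp (g y) * outlier_score d m M (add_mset z D) y"
      "1 - outlier_score d m M D y \<le> exp (g y) * (1 - outlier_score d m M (add_mset z D) y)"
      if yD: "y \<in># D" for y
    proof -
      have y: "0 \<le> d y z" "d y z \<le> 1" using d_bounds by auto
      define u where "u = mean_distance d D y"
      define u' where "u' = mean_distance d (add_mset z D) y"
      have u: "0 \<le> u" "u \<le> 1" "0 \<le> u'" "u' \<le> 1"
        using mean_distance_bounds[of d] d_bounds by (auto simp: u_def u'_def)
      have u'_eq: "u' = (real n * u + d y z) / (real n + 1)"
        by (simp add: u'_def u_def n_def mean_distance_add_mset)
      have "u \<le> d y z + \<sigma>"
        unfolding \<sigma>_def u_def by (rule mean_distance_triangle[OF False])
      then have "real n * u \<le> real n * (d y z + \<sigma>)" by (intro mult_left_mono) auto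
      then have "u' \<le> (real n * (d y z + \<sigma>) + d y z) / (real n + 1)"
        unfolding u'_eq by (intro divide_right_mono) auto
      also have "\<dots> = d y z + real n / (real n + 1) * \<sigma>" by (simp add: field_simps)
      finally have t: "u' \<le> d y z + real n / (real n + 1) * \<sigma>" .
      \<comment> \<open>If \<open>D\<close> has one record, that record is \<open>y\<close>, whose
        distance to itself is zero; this is why \<open>y\<close> is required to lie in
        \<open>D\<close>.\<close>
      have single: "u' \<le> d y z" if "n = 1"
      proof -
        have "size D = 1" using that by (simp add: n_def)
        then obtain x where "D = {#x#}" using size_1_singleton_mset by blast
        then have "u = 0" using yD d_refl by (simp add: u_def mean_distance_def)
        then show ?thesis using that y by (simp add: u'_eq)
      qed
      note r = backward_ratio[OF n y u(1,2) u'_eq ab(1)[OF y] ab(2)[OF y u(3,4) t single]]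
      show "outlier_score d m M D y \<le> exp (g y) * outlier_score d m M (add_mset z D) y"
        "1 - outlier_score d m M D y \<le> exp (g y) * (1 - outlier_score d m M (add_mset z D) y)"
        using r by (simp_all add: outlier_score_eq False g_def u_def u'_def)
    qed
    show "indep_deletion_prob (outlier_score d m M D) D C
        \<le> exp (\<Sum>y\<in>#D. g y) * indep_deletion_prob (outlier_score d m M (add_mset z D)) D C"
    proof (rule indep_deletion_prob_ratio[OF C _ ratio])
      fix y
      show "0 \<le> outlier_score d m M D y \<and> outlier_score d m M D y \<le> 1"
        using outlier_score_bounds[OF False, of y] m_pos M_less_1 by simp
    qed
  qed
qed

end

section \<open>Privacy of the composition\<close>

lemma l1_eq:
  assumes "0 < m" "m \<le> M" "M < 1" "0 \<le> p" "p \<le> 1"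
  shows "l1 \<epsilon> m M p = gain_up (exp \<epsilon> - 1) (m + (M - m) * p) + p * ((M - m) / m)
    + (1 - p) * p * ((M - m) / (1 - m - (M - m) * p))"
proof -
  define x where "x = m + (M - m) * p"
  have "(M - m) * p \<le> M - m" using assms by (simp add: mult_left_le)
  then have x: "0 < 1 - x" using assms by (simp add: x_def)
  have e: "p * M + (1 - p) * m = x" "1 - m - (M - m) * p = 1 - x" by (auto simp: x_def algebra_simps)
  have "exp \<epsilon> - (exp \<epsilon> - 1) * x = 1 + (exp \<epsilon> - 1) * (1 - x)" by (simp add: algebra_simps)
  moreover have "p * (M / m) = p * ((M - m) / m) + p" using assms by (simp add: field_simps)
  moreover have "(1 - m) / (1 - x) = p * ((M - m) / (1 - x)) + 1"
    using x by (simp add: field_simps) (simp add: x_def algebra_simps)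
  then have "(1 - p) * ((1 - m) / (1 - x)) = (1 - p) * p * ((M - m) / (1 - x)) + (1 - p)"
    by (simp add: distrib_left)
  ultimately show ?thesis unfolding l1_def gain_up_def e x_def[symmetric] by simp
qed

text \<open>With \<open>y = 2 - p\<close> the inner fraction of \<open>l2\<close> becomes
  \<open>M - (M - m) / y\<close>; in the majorant argument \<open>y\<close> is the reciprocal of the
  mean distance.\<close>

lemma l2_eq:
  assumes "0 < m" "m \<le> M" "M < 1" "1 \<le> y"
  shows "l2 \<epsilon> m M (2 - y) = gain_up (exp \<epsilon> - 1) (m + (M - m) / y)
    + (M - m) / y * ((2 * y - y\<^sup>2) / m + (y - 1) / (1 - M))"
proof -
  define x where "x = m + (M - m) / y"
  define r where "r = ((M + m) - (2 - y) * M) / (2 - (2 - y))"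
  have r: "r = M - (M - m) / y" using assms by (simp add: r_def field_simps)
  have e: "(2 - y) * M + (1 - (2 - y)) * r = x"
    using assms by (simp add: r x_def field_simps)
  have "exp \<epsilon> - (exp \<epsilon> - 1) * x = 1 + (exp \<epsilon> - 1) * (1 - x)" by (simp add: algebra_simps)
  moreover have "(2 - y) * (M / m) = (M - m) / y * ((2 * y - y\<^sup>2) / m) + (2 - y)"
    using assms by (simp add: field_simps power2_eq_square)
  moreover have "(1 - r) / (1 - M) = (M - m) / y / (1 - M) + 1"
  proof -
    have e: "1 - r = (M - m) / y + (1 - M)" by (simp add: r)
    show ?thesis unfolding e using assms by (simp add: add_divide_distrib)
  qed
  then have "(1 - (2 - y)) * ((1 - r) / (1 - M)) = (M - m) / y * ((y - 1) / (1 - M)) + (y - 1)"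
    by (simp add: distrib_left mult.commute)
  ultimately show ?thesis
    unfolding l2_def gain_up_def Let_def r_def[symmetric] e x_def[symmetric] by (simp add: distrib_left)
qed

lemma l3_eq:
  assumes "0 < m" "m \<le> M" "M < 1" "0 \<le> \<epsilon>"
  shows "l3 \<epsilon> m M = gain_down (exp \<epsilon> - 1) M + (M - m) / (1 - m)"
proof -
  have "0 \<le> (exp \<epsilon> - 1) * M" using assms by simp
  then have pos: "0 < 1 + (exp \<epsilon> - 1) * M" by linarith
  have "exp (- \<epsilon>) + (1 - exp (- \<epsilon>)) * M = (1 + (exp \<epsilon> - 1) * M) / exp \<epsilon>"
    by (simp add: exp_minus field_simps)
  then have "- ln (exp (- \<epsilon>) + (1 - exp (- \<epsilon>)) * M) = gain_down (exp \<epsilon> - 1) M"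
    using pos by (simp add: gain_down_def ln_div)
  moreover have "1 - (1 - M) / (1 - m) = (M - m) / (1 - m)" using assms by (simp add: field_simps)
  ultimately show ?thesis unfolding l3_def by linarith
qed

text \<open>A real supremum bounds its members only if the set is bounded above. Here the set is the
  continuous image of a compact interval.\<close>

lemma eps_bound_ge:
  assumes "0 < m" "m \<le> M" "M < 1" "0 \<le> \<epsilon>" and p: "0 \<le> p" "p \<le> 1"
  shows "max (max (l1 \<epsilon> m M p) (l2 \<epsilon> m M p)) (l3 \<epsilon> m M) \<le> eps_bound \<epsilon> m M"
proof -
  let ?f = "exp \<epsilon> - 1"
  have f: "0 \<le> ?f" using assms by simp
  have pos: "0 < 1 + ?f * (1 - (m + (M - m) * t))" if "0 \<le> t" "t \<le> 1" for t
  proof -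
    have "(M - m) * t \<le> M - m" using assms that by (simp add: mult_left_le)
    then have "0 \<le> ?f * (1 - (m + (M - m) * t))" using f assms by (intro mult_nonneg_nonneg) auto
    then show ?thesis by linarith
  qed
  have den: "1 - m - (M - m) * t \<noteq> 0" if "0 \<le> t" "t \<le> 1" for t
    using mult_left_le[of t "M - m"] assms that by auto
  have "continuous_on {0..1} (\<lambda>p. gain_up ?f (m + (M - m) * p) + p * ((M - m) / m)
      + (1 - p) * p * ((M - m) / (1 - m - (M - m) * p)))"
    unfolding gain_up_def using pos den assms
    by (intro continuous_intros) (auto simp: less_imp_neq[symmetric])
  then have c1: "continuous_on {0..1} (l1 \<epsilon> m M)"
    by (rule continuous_on_eq) (use assms in \<open>simp add: l1_eq\<close>)
  have "continuous_on {0..1} (\<lambda>p. gain_up ?f (m + (M - m) / (2 - p))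
      + (M - m) / (2 - p) * ((2 * (2 - p) - (2 - p)\<^sup>2) / m + ((2 - p) - 1) / (1 - M)))"
  proof -
    have "1 + ?f * (1 - (m + (M - m) / (2 - t))) \<noteq> 0" if "t \<in> {0..1}" for t
      using pos[of "1 / (2 - t)"] that by (auto simp: divide_simps)
    then show ?thesis unfolding gain_up_def using assms by (intro continuous_intros) auto
  qed
  then have c2: "continuous_on {0..1} (l2 \<epsilon> m M)"
  proof (rule continuous_on_eq)
    fix t :: real assume "t \<in> {0..1}"
    then show "gain_up ?f (m + (M - m) / (2 - t))
      + (M - m) / (2 - t) * ((2 * (2 - t) - (2 - t)\<^sup>2) / m + ((2 - t) - 1) / (1 - M)) = l2 \<epsilon> m M t"
      using l2_eq[of m M "2 - t" \<epsilon>] assms by simp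
  qed
  have "compact ((\<lambda>p. max (max (l1 \<epsilon> m M p) (l2 \<epsilon> m M p)) (l3 \<epsilon> m M)) ` {0..1})"
    by (intro compact_continuous_image continuous_intros c1 c2 compact_Icc)
  then have "bdd_above ((\<lambda>p. max (max (l1 \<epsilon> m M p) (l2 \<epsilon> m M p)) (l3 \<epsilon> m M)) ` {0..1})"
    by (intro bounded_imp_bdd_above compact_imp_bounded)
  then show ?thesis unfolding eps_bound_def using p by (intro cSUP_upper) auto
qed

lemma suppression_bound_eps_bound:
  assumes "0 < m" "m \<le> M" "M < 1" "0 \<le> \<epsilon>"
  shows "suppression_bound m M (exp \<epsilon> - 1) (eps_bound \<epsilon> m M)"
proof
  fix p :: real assume "0 \<le> p" "p \<le> 1"
  then show "gain_up (exp \<epsilon> - 1) (m + (M - m) * p) + p * ((M - m) / m)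
      + (1 - p) * p * ((M - m) / (1 - m - (M - m) * p)) \<le> eps_bound \<epsilon> m M"
    using eps_bound_ge[OF assms, of p] l1_eq[OF assms(1-3), of p \<epsilon>] by simp
next
  fix y :: real assume "1 \<le> y" "y \<le> 2"
  then show "gain_up (exp \<epsilon> - 1) (m + (M - m) / y)
      + (M - m) / y * ((2 * y - y\<^sup>2) / m + (y - 1) / (1 - M)) \<le> eps_bound \<epsilon> m M"
    using eps_bound_ge[OF assms, of "2 - y"] l2_eq[OF assms(1-3), of y \<epsilon>] by simp
next
  show "gain_down (exp \<epsilon> - 1) M + (M - m) / (1 - m) \<le> eps_bound \<epsilon> m M"
    using eps_bound_ge[OF assms, of 0] l3_eq[OF assms] by simp
qed (use assms in auto)

lemma comp_prob_sum:
  assumes "suppression \<D> S" "D \<in> \<D>"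
    and "\<forall>C. C \<subseteq># D \<longrightarrow> pmf (S D) C = indep_deletion_prob q D C"
  shows "comp_prob Mech S D E = (\<Sum>C | C \<subseteq># D. indep_deletion_prob q D C * measure (Mech C) E)"
    and "(\<Sum>C | C \<subseteq># D. indep_deletion_prob q D C) = 1"
proof -
  have supp: "set_pmf (S D) \<subseteq> {C. C \<subseteq># D}" using assms(1,2) by (auto simp: suppression_def)
  have "comp_prob Mech S D E = (\<Sum>C | C \<subseteq># D. measure (Mech C) E * pmf (S D) C)"
    unfolding comp_prob_def using supp by (intro integral_measure_pmf_real finite_submultisets) auto
  also have "\<dots> = (\<Sum>C | C \<subseteq># D. indep_deletion_prob q D C * measure (Mech C) E)"
    using assms(3) by (intro sum.cong) auto
  finally show "comp_prob Mech S D E = (\<Sum>C | C \<subseteq># D. indep_deletion_prob q D C * measure (Mech C) E)" .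
  have "(\<Sum>C | C \<subseteq># D. indep_deletion_prob q D C) = (\<Sum>C | C \<subseteq># D. pmf (S D) C)"
    using assms(3) by (intro sum.cong) auto
  \<comment> \<open>The weights sum to one because they agree with a \<open>pmf\<close> on a finite
    set containing its support.\<close>
  then show "(\<Sum>C | C \<subseteq># D. indep_deletion_prob q D C) = 1"
    using sum_pmf_eq_1[OF finite_submultisets supp] by simp
qed

text \<open>Here \<open>a\<close> and \<open>b\<close> are the event probabilities without and with
  \<open>z\<close>. Only the share \<open>1 - x\<close> of the mixture that keeps \<open>z\<close>
  uses privacy, so the additive error shrinks to \<open>\<delta> * (1 - x)\<close>.\<close>

lemma mixture_le_of_dp:
  fixes a b x f \<delta> m :: real
  assumes "b \<le> (1 + f) * a + \<delta>" "0 \<le> f" "m \<le> x" "x \<le> 1" "0 \<le> \<delta>"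
  shows "(1 - x) * b + x * a \<le> exp (gain_up f x) * a + \<delta> * (1 - m)"
proof -
  have "0 \<le> f * (1 - x)" using assms by simp
  then have e: "exp (gain_up f x) = 1 + f * (1 - x)" unfolding gain_up_def by (intro exp_ln) linarith
  have "(1 - x) * b \<le> (1 - x) * ((1 + f) * a + \<delta>)" using assms by (intro mult_left_mono) auto
  moreover have "\<delta> * (1 - x) \<le> \<delta> * (1 - m)" using assms by (intro mult_left_mono) auto
  ultimately show ?thesis unfolding e by (simp add: algebra_simps)
qed

lemma le_mixture_of_dp:
  fixes a b x f \<delta> m :: real
  assumes "a \<le> (1 + f) * b + \<delta>" "0 \<le> f" "0 \<le> x" "m \<le> x" "x \<le> 1" "0 \<le> \<delta>"
  shows "a \<le> exp (gain_down f x) * ((1 - x) * b + x * a) + \<delta> * (1 - m)"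
proof -
  have "0 \<le> f * x" using assms by simp
  then have p: "0 < 1 + f * x" by linarith
  have e: "exp (gain_down f x) = (1 + f) / (1 + f * x)"
    unfolding gain_down_def using p assms by (intro exp_ln) auto
  have "(1 - x) * a \<le> (1 - x) * ((1 + f) * b + \<delta>)" using assms by (intro mult_left_mono) auto
  \<comment> \<open>Splitting \<open>a * (1 + f * x) = (1 - x) * a + (1 + f) * x * a\<close> applies
    privacy only to the part that is missing from the mixture.\<close>
  then have "a * (1 + f * x) \<le> (1 + f) * ((1 - x) * b + x * a) + \<delta> * (1 - x)"
    by (simp add: algebra_simps)
  also have "\<delta> * (1 - x) \<le> \<delta> * (1 - m) * 1" using assms by (simp add: mult_left_mono)
  also have "\<delta> * (1 - m) * 1 \<le> \<delta> * (1 - m) * (1 + f * x)"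
    using assms \<open>0 \<le> f * x\<close> by (intro mult_left_mono) auto
  finally have "a * (1 + f * x) \<le> (1 + f) * ((1 - x) * b + x * a) + \<delta> * (1 - m) * (1 + f * x)" by simp
  then have "a \<le> ((1 + f) * ((1 - x) * b + x * a) + \<delta> * (1 - m) * (1 + f * x)) / (1 + f * x)"
    using p by (simp add: pos_le_divide_eq)
  also have "\<dots> = exp (gain_down f x) * ((1 - x) * b + x * a) + \<delta> * (1 - m)"
  proof -
    have "(c * y + t * r) / r = c / r * y + t" if "0 < r" for c y t r :: real
      using that by (simp add: add_divide_distrib)
    then show ?thesis using p unfolding e .
  qed
  finally show ?thesis .
qed

theorem theorem3:
  fixes \<D> :: "'a multiset set" and R :: "'r measure"
    and d :: "'a \<Rightarrow> 'a \<Rightarrow> real" and m M \<epsilon> \<delta> :: real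
    and S :: "'a multiset \<Rightarrow> 'a multiset pmf" and Mech :: "'a multiset \<Rightarrow> 'r measure"
  assumes "subset_closed \<D>"
    and "normalized_distance d"
    and "0 < m" and "m \<le> M" and "M < 1"
    and "0 \<le> \<epsilon>" and "0 \<le> \<delta>"
    and "suppression \<D> S"
    and "\<forall>D\<in>\<D>. \<forall>C. C \<subseteq># D \<longrightarrow>
           pmf (S D) C = indep_deletion_prob (outlier_score d m M D) D C"
    and "mechanism \<D> R Mech"
    and "unbounded_DP \<D> R (\<lambda>D E. measure (Mech D) E) \<epsilon> \<delta>"
  shows "\<exists>\<epsilon>S. \<bar>\<epsilon>S - eps_bound \<epsilon> m M\<bar> \<le> 2 * 10 powi (-7) \<and>
           unbounded_DP \<D> R (comp_prob Mech S) \<epsilon>S (\<delta> * (1 - m))"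
proof -
  define f where "f = exp \<epsilon> - 1"
  define B where "B = eps_bound \<epsilon> m M"
  have ef: "exp \<epsilon> = 1 + f" by (simp add: f_def)
  interpret suppression_bound m M f B
    unfolding f_def B_def using assms(3-6) by (rule suppression_bound_eps_bound)
  interpret distance_suppression m M f B d
    by unfold_locales (rule assms(2))
  have "comp_prob Mech S D E \<le> exp B * comp_prob Mech S (add_mset z D) E + \<delta> * (1 - m)
      \<and> comp_prob Mech S (add_mset z D) E \<le> exp B * comp_prob Mech S D E + \<delta> * (1 - m)"
    if D: "D \<in> \<D>" "add_mset z D \<in> \<D>" and E: "E \<in> sets R" for D z E
  proof -
    define q q' where "q = outlier_score d m M D" and "q' = outlier_score d m M (add_mset z D)"
    define w w' where "w = indep_deletion_prob q D" and "w' = indep_deletion_prob q' D"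
    define P where "P C = measure (Mech C) E" for C
    define X where "X C = (1 - q' z) * P (add_mset z C) + q' z * P C" for C
    have q'01: "m \<le> q' y" "q' y \<le> M" for y
      using outlier_score_bounds[of "add_mset z D" y] by (auto simp: q'_def)
    have q'z: "m \<le> q' z" "q' z \<le> 1" "0 \<le> q' z" using q'01[of z] m_pos M_less_1 by auto
    have old: "comp_prob Mech S D E = (\<Sum>C | C \<subseteq># D. w C * P C)" and w1: "(\<Sum>C | C \<subseteq># D. w C) = 1"
      using comp_prob_sum[OF assms(8) D(1)] assms(9) D by (auto simp: q_def w_def P_def)
    have new: "comp_prob Mech S (add_mset z D) E = (\<Sum>C | C \<subseteq># D. w' C * X C)"
      using comp_prob_sum(1)[OF assms(8) D(2), of q' Mech E] assms(9) D sum_indep_deletion_prob_add_mset[of q' z D "\<lambda>C. measure (Mech C) E"]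
      by (auto simp: q'_def w'_def X_def P_def)
    \<comment> \<open>\<open>w'\<close> uses the scores of \<open>D'\<close> on sub-multisets of
      \<open>D\<close>; it inherits total mass one from the law on \<open>D'\<close>, because
      \<open>(1 - q' z) + q' z = 1\<close>.\<close>
    have w'1: "(\<Sum>C | C \<subseteq># D. w' C) = 1"
      using comp_prob_sum(2)[OF assms(8) D(2), of q'] assms(9) D sum_indep_deletion_prob_add_mset[of q' z D "\<lambda>_. 1"]
      by (auto simp: q'_def w'_def)
    have w'_nonneg: "0 \<le> w' C" for C
      unfolding w'_def
    proof (rule indep_deletion_prob_nonneg)
      show "0 \<le> q' y \<and> q' y \<le> 1" for y using q'01[of y] m_pos M_less_1 by auto
    qed
    have w_nonneg: "0 \<le> w C" for C
      unfolding w_def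
    proof (rule indep_deletion_prob_nonneg)
      fix y assume "y \<in># D"
      then have "D \<noteq> {#}" by auto
      then show "0 \<le> q y \<and> q y \<le> 1"
        using outlier_score_bounds[of D y] m_pos M_less_1 by (auto simp: q_def)
    qed
    have P_nonneg: "0 \<le> P C" for C by (simp add: P_def)
    have X_nonneg: "0 \<le> X C" for C using q'z P_nonneg by (simp add: X_def)
    have dp: "P C \<le> (1 + f) * P (add_mset z C) + \<delta>" "P (add_mset z C) \<le> (1 + f) * P C + \<delta>"
      if "C \<subseteq># D" for C
    proof -
      have "add_mset z C \<subseteq># add_mset z D" using that by simp
      then have "C \<in> \<D>" "add_mset z C \<in> \<D>" using that D assms(1) unfolding subset_closed_def by blast+
      then show "P C \<le> (1 + f) * P (add_mset z C) + \<delta>" "P (add_mset z C) \<le> (1 + f) * P C + \<delta>"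
        using assms(11) E unfolding unbounded_DP_def P_def ef by blast+
    qed
    have "(\<Sum>C | C \<subseteq># D. w' C * X C) \<le> exp B * (\<Sum>C | C \<subseteq># D. w C * P C) + \<delta> * (1 - m)"
    proof -
      obtain G where G: "\<And>C. C \<subseteq># D \<Longrightarrow> w' C \<le> exp G * w C" "gain_up f (q' z) + G \<le> B"
        using forward_weights[of D z] unfolding q_def q'_def w_def w'_def by metis
      \<comment> \<open>The additive error stays weighted by \<open>w'\<close>, so that summing over
        \<open>C\<close> gives \<open>\<delta> * (1 - m)\<close> once.\<close>
      have "w' C * X C \<le> exp B * (w C * P C) + \<delta> * (1 - m) * w' C" if C: "C \<subseteq># D" for C
      proof -
        have "w' C * X C \<le> w' C * (exp (gain_up f (q' z)) * P C + \<delta> * (1 - m))"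
          unfolding X_def using dp[OF C] f_nonneg q'z assms(7) w'_nonneg
          by (intro mult_left_mono mixture_le_of_dp) auto
        moreover have "exp (gain_up f (q' z)) * P C * w' C \<le> exp (gain_up f (q' z)) * P C * (exp G * w C)"
          using G(1)[OF C] P_nonneg by (intro mult_left_mono) auto
        moreover have "exp (gain_up f (q' z)) * P C * (exp G * w C) = exp (gain_up f (q' z) + G) * (w C * P C)"
          by (simp add: exp_add)
        moreover have "exp (gain_up f (q' z) + G) * (w C * P C) \<le> exp B * (w C * P C)"
          using G(2) w_nonneg P_nonneg by (intro mult_right_mono) auto
        moreover have "w' C * (exp (gain_up f (q' z)) * P C + \<delta> * (1 - m))
            = exp (gain_up f (q' z)) * P C * w' C + \<delta> * (1 - m) * w' C" by (simp add: algebra_simps)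
        ultimately show ?thesis by linarith
      qed
      then have "(\<Sum>C | C \<subseteq># D. w' C * X C) \<le> (\<Sum>C | C \<subseteq># D. exp B * (w C * P C) + \<delta> * (1 - m) * w' C)"
        by (intro sum_mono) auto
      also have "\<dots> = exp B * (\<Sum>C | C \<subseteq># D. w C * P C) + \<delta> * (1 - m) * (\<Sum>C | C \<subseteq># D. w' C)"
        by (simp add: sum.distrib sum_distrib_left)
      finally show ?thesis by (simp add: w'1)
    qed
    moreover have "(\<Sum>C | C \<subseteq># D. w C * P C) \<le> exp B * (\<Sum>C | C \<subseteq># D. w' C * X C) + \<delta> * (1 - m)"
    proof -
      obtain G where G: "\<And>C. C \<subseteq># D \<Longrightarrow> w C \<le> exp G * w' C" "gain_down f (q' z) + G \<le> B"
        using backward_weights[of D z] unfolding q_def q'_def w_def w'_def by metis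
      have "w C * P C \<le> exp B * (w' C * X C) + \<delta> * (1 - m) * w C" if C: "C \<subseteq># D" for C
      proof -
        have "w C * P C \<le> w C * (exp (gain_down f (q' z)) * X C + \<delta> * (1 - m))"
          unfolding X_def using dp[OF C] f_nonneg q'z assms(7) w_nonneg
          by (intro mult_left_mono le_mixture_of_dp) auto
        moreover have "exp (gain_down f (q' z)) * X C * w C \<le> exp (gain_down f (q' z)) * X C * (exp G * w' C)"
          using G(1)[OF C] X_nonneg by (intro mult_left_mono) auto
        moreover have "exp (gain_down f (q' z)) * X C * (exp G * w' C) = exp (gain_down f (q' z) + G) * (w' C * X C)"
          by (simp add: exp_add)
        moreover have "exp (gain_down f (q' z) + G) * (w' C * X C) \<le> exp B * (w' C * X C)"
          using G(2) w'_nonneg X_nonneg by (intro mult_right_mono) auto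
        moreover have "w C * (exp (gain_down f (q' z)) * X C + \<delta> * (1 - m))
            = exp (gain_down f (q' z)) * X C * w C + \<delta> * (1 - m) * w C" by (simp add: algebra_simps)
        ultimately show ?thesis by linarith
      qed
      then have "(\<Sum>C | C \<subseteq># D. w C * P C) \<le> (\<Sum>C | C \<subseteq># D. exp B * (w' C * X C) + \<delta> * (1 - m) * w C)"
        by (intro sum_mono) auto
      also have "\<dots> = exp B * (\<Sum>C | C \<subseteq># D. w' C * X C) + \<delta> * (1 - m) * (\<Sum>C | C \<subseteq># D. w C)"
        by (simp add: sum.distrib sum_distrib_left)
      finally show ?thesis by (simp add: w1)
    qed
    ultimately show ?thesis unfolding old new by blast
  qed
  then have "unbounded_DP \<D> R (comp_prob Mech S) B (\<delta> * (1 - m))"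
    unfolding unbounded_DP_def by blast
  \<comment> \<open>The witness is the maximum itself, so the tolerance is met with difference
    zero.\<close>
  moreover have "\<bar>B - eps_bound \<epsilon> m M\<bar> \<le> 2 * 10 powi (-7)" by (simp add: B_def)
  ultimately show ?thesis by blast
qed

end
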